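(* Let $\mathfrak g$ be a finite dimensional simple Lie algebra over $\mathbb C$, $\tau$ a Chevalley automorphism of $\mathfrak g$ and $\sigma$ a non-trivial graph automorphism of $\mathfrak g$ (of order $m$). Let $\mathcal A$ be a quantum torus based on a free abelian group $\Lambda$ of finite rank and $\rho:\Lambda\to\mathbb Z_m$ a group epimorphism. Then $\bar\tau_\psi$ is a Chevalley automorphism of $\hat L_\rho(\mathfrak g,\mathcal A)$, where $\psi=\mathrm{id}$ if $\sigma$ has order $2$, and $\psi$ is a graph automorphism of order $2$ otherwise. In particular, if $\mathcal A$ is the algebra of Laurent polynomials in one variable, then $\bar\tau_\psi$ is a Chevalley automorphism of the affine Lie algebra $\hat L_\rho(\mathfrak g,\mathcal A)$.
   Context: All algebras are over $\mathbb C$. $\mathfrak g$ has Cartan subalgebra $\mathfrak h$, standard Chevalley generators $h_{\alpha_i},E_{\pm i}$, and a non-degenerate invariant symmetric bilinear form $(\cdot,\cdot)$. A graph automorphism is the automorphism of $\mathfrak g$ permuting the standard Chevalley generators according to an automorphism of the Dynkin diagram. A Chevalley automorphism of a Lie algebra with distinguished Cartan subalgebra is a finite order automorphism acting as $-\mathrm{id}$ on that subalgebra. Quantum torus: $\mathcal A=\bigoplus_{\lambda\in\Lambda}\mathbb C a^\lambda$, $\mathcal A^\lambda=\mathbb Ca^\lambda$, $a^\lambda a^\gamma=\mu(\lambda,\gamma)a^{\lambda+\gamma}$ with $\mu:\Lambda\times\Lambda\to\mathbb C^\times$ a 2-cocycle satisfying $\mu(\lambda,\tau)=\mu(\tau,\lambda)=\mu(-\lambda,-\tau)$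 and $\mu(0,0)=1$; form $\epsilon(a^\lambda,a^\tau)=\mu(\lambda,\tau)\delta_{\lambda,-\tau}$. With $\omega=e^{2\pi i/m}$, $\mathfrak g^{\bar j}=\{x\in\mathfrak g\mid\sigma(x)=\omega^jx\}$; $\mathfrak h^\sigma$ is the fixed point space of $\sigma$ in $\mathfrak h$; $\bar\lambda=\rho(\lambda)$. On $\mathfrak g\otimes\mathcal A$: $[x\otimes a,y\otimes b]=[x,y]\otimes ab$, $(x\otimes a,y\otimes b)=(x,y)\epsilon(a,b)$. $L_\rho(\mathfrak g,\mathcal A)=\bigoplus_\lambda\mathfrak g^{\bar\lambda}\otimes\mathcal A^\lambda$. Let $\mathcal V=\mathbb C\otimes_{\mathbb Z}\Lambda\supseteq\Lambda$. $\hat L_\rho(\mathfrak g,\mathcal A)=L_\rho(\mathfrak g,\mathcal A)\oplus\mathcal V\oplus\mathcal V^\star$ with bracket: $[d,x]=d(\lambda)x$ for $d\in\mathcal V^\star$, $x$ of degree $\lambda$; $\mathcal V$ central; $[\mathcal V^\star,\mathcal V^\star]=0$; $[x,y]=[x,y]_{L_\rho}+(x,y)\lambda$ for $x$ of degree $\lambda$ and $y\in L_\rho(\mathfrak g,\mathcal A)$. Its Cartan subalgebra is $\hat{\mathfrak h}=(\mathfrak h^\sigma\otimes1)\oplus\mathcal V\oplus\mathcal V^\star$. For an automorphism $\psi$ of $\mathfrak g$, $\bar\tau_\psi$ is the map $x\otimes a^\lambda+\gamma+d\mapsto\psi\tau(x)\otimes a^{-\lambda}-\gamma-d$ ($x\in\mathfrak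 g^{\bar\lambda}$, $\lambda\in\Lambda$, $\gamma\in\mathcal V$, $d\in\mathcal V^\star$).
   Formalization: The formal statement additionally assumes that τ commutes with σ; without this the claim fails (e.g. sl_3 with τ(E_i)=c_iE_{-i}, c_1≠c_2, where the map does not preserve L_ρ), and the standard Chevalley automorphism E_i ↦ -E_{-i} satisfies it. *)

theory Defs
  imports Complex_Main "HOL-Algebra.Free_Abelian_Groups" "HOL-Library.Poly_Mapping"
    "HOL-Library.Function_Algebras" "HOL-Library.Product_Plus"
begin

section \<open>Lie algebras over the complex numbers\<close>

locale lie_algebra = vector_space scale
  for scale :: "complex \<Rightarrow> 'g::ab_group_add \<Rightarrow> 'g" +
  fixes br :: "'g \<Rightarrow> 'g \<Rightarrow> 'g"
  assumes br_add_left: "br (x + y) z = br x z + br y z"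
    and br_add_right: "br x (y + z) = br x y + br x z"
    and br_scale_left: "br (scale c x) y = scale c (br x y)"
    and br_scale_right: "br x (scale c y) = scale c (br x y)"
    and br_self: "br x x = 0"
    and jacobi: "br x (br y z) + br y (br z x) + br z (br x y) = 0"

definition finite_dimensional :: "(complex \<Rightarrow> 'g::ab_group_add \<Rightarrow> 'g) \<Rightarrow> bool" where
  "finite_dimensional scale \<longleftrightarrow> (\<exists>B. finite B \<and> module.span scale B = UNIV)"

definition lie_ideal ::
  "(complex \<Rightarrow> 'g::ab_group_add \<Rightarrow> 'g) \<Rightarrow> ('g \<Rightarrow> 'g \<Rightarrow> 'g) \<Rightarrow> 'g set \<Rightarrow> bool" where
  "lie_ideal scale br I \<longleftrightarrow> module.subspace scale I \<and> (\<forall>x. \<forall>y\<in>I. br x y \<in> I)"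

definition simple_lie_algebra ::
  "(complex \<Rightarrow> 'g::ab_group_add \<Rightarrow> 'g) \<Rightarrow> ('g \<Rightarrow> 'g \<Rightarrow> 'g) \<Rightarrow> bool" where
  "simple_lie_algebra scale br \<longleftrightarrow>
     lie_algebra scale br \<and> (\<exists>x y. br x y \<noteq> 0) \<and>
     (\<forall>I. lie_ideal scale br I \<longrightarrow> I = {0} \<or> I = UNIV)"

definition lie_subalgebra ::
  "(complex \<Rightarrow> 'g::ab_group_add \<Rightarrow> 'g) \<Rightarrow> ('g \<Rightarrow> 'g \<Rightarrow> 'g) \<Rightarrow> 'g set \<Rightarrow> bool" where
  "lie_subalgebra scale br S \<longleftrightarrow> module.subspace scale S \<and> (\<forall>x\<in>S. \<forall>y\<in>S. br x y \<in> S)"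

primrec lower_central_series ::
  "(complex \<Rightarrow> 'g::ab_group_add \<Rightarrow> 'g) \<Rightarrow> ('g \<Rightarrow> 'g \<Rightarrow> 'g) \<Rightarrow> 'g set \<Rightarrow> nat \<Rightarrow> 'g set" where
  "lower_central_series scale br S 0 = S"
| "lower_central_series scale br S (Suc n) =
     module.span scale {br x y |x y. x \<in> S \<and> y \<in> lower_central_series scale br S n}"

definition cartan_subalgebra ::
  "(complex \<Rightarrow> 'g::ab_group_add \<Rightarrow> 'g) \<Rightarrow> ('g \<Rightarrow> 'g \<Rightarrow> 'g) \<Rightarrow> 'g set \<Rightarrow> bool" where
  "cartan_subalgebra scale br H \<longleftrightarrow>
     lie_subalgebra scale br H \<and>
     (\<exists>n. lower_central_series scale br H n = {0}) \<and>
     {x. \<forall>y\<in>H. br x y \<in> H} = H"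

definition nondegenerate_invariant_form ::
  "(complex \<Rightarrow> 'g::ab_group_add \<Rightarrow> 'g) \<Rightarrow> ('g \<Rightarrow> 'g \<Rightarrow> 'g) \<Rightarrow> ('g \<Rightarrow> 'g \<Rightarrow> complex) \<Rightarrow> bool" where
  "nondegenerate_invariant_form scale br form \<longleftrightarrow>
     (\<forall>x. Vector_Spaces.linear scale (*) (form x)) \<and>
     (\<forall>x y. form x y = form y x) \<and>
     (\<forall>x y z. form (br x y) z = form x (br y z)) \<and>
     (\<forall>x. (\<forall>y. form x y = 0) \<longrightarrow> x = 0)"

subsection \<open>Automorphisms\<close>

text \<open>The carrier \<open>L\<close> is explicit because the extended twisted algebra below is a proper
  subset of its ambient type.\<close>

definition lie_automorphism ::
  "(complex \<Rightarrow> 'g::ab_group_add \<Rightarrow> 'g) \<Rightarrow> ('g \<Rightarrow> 'g \<Rightarrow> 'g) \<Rightarrow> 'g set \<Rightarrow> ('g \<Rightarrow> 'g) \<Rightarrow> bool" where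
  "lie_automorphism scale br L f \<longleftrightarrow>
     bij_betw f L L \<and>
     (\<forall>x\<in>L. \<forall>y\<in>L. f (x + y) = f x + f y) \<and>
     (\<forall>c. \<forall>x\<in>L. f (scale c x) = scale c (f x)) \<and>
     (\<forall>x\<in>L. \<forall>y\<in>L. f (br x y) = br (f x) (f y))"

definition chevalley_automorphism ::
  "(complex \<Rightarrow> 'g::ab_group_add \<Rightarrow> 'g) \<Rightarrow> ('g \<Rightarrow> 'g \<Rightarrow> 'g) \<Rightarrow> 'g set \<Rightarrow> 'g set
    \<Rightarrow> ('g \<Rightarrow> 'g) \<Rightarrow> bool" where
  "chevalley_automorphism scale br L H f \<longleftrightarrow>
     lie_automorphism scale br L f \<and>
     (\<exists>n>0. \<forall>x\<in>L. (f ^^ n) x = x) \<and>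
     (\<forall>x\<in>H. f x = - x)"

definition has_order :: "('g \<Rightarrow> 'g) \<Rightarrow> nat \<Rightarrow> bool" where
  "has_order f m \<longleftrightarrow> 0 < m \<and> f ^^ m = id \<and> (\<forall>k. 0 < k \<and> k < m \<longrightarrow> f ^^ k \<noteq> id)"

subsection \<open>Chevalley generators and graph automorphisms\<close>

definition cartan_matrix :: "('i::finite \<Rightarrow> 'i \<Rightarrow> int) \<Rightarrow> bool" where
  "cartan_matrix a \<longleftrightarrow>
     (\<forall>i. a i i = 2) \<and>
     (\<forall>i j. i \<noteq> j \<longrightarrow> a i j \<le> 0) \<and>
     (\<forall>i j. a i j = 0 \<longrightarrow> a j i = 0) \<and>
     (\<exists>d::'i \<Rightarrow> real. (\<forall>i. d i > 0) \<and>
        (\<forall>i j. d i * of_int (a i j) = d j * of_int (a j i)) \<and>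
        (\<forall>v::'i \<Rightarrow> real. (\<exists>i. v i \<noteq> 0) \<longrightarrow>
           (\<Sum>i\<in>UNIV. \<Sum>j\<in>UNIV. d i * of_int (a i j) * v i * v j) > 0))"

text \<open>\<open>e i\<close>, \<open>f i\<close> are $E_i$, $E_{-i}$ and \<open>h i\<close> is the coroot $h_{\alpha_i}$; the simple root
  $\alpha_j$ is the functional on \<open>H\<close> given by $\alpha_j(h_i) = a_{ij}$.  Since \<open>'i\<close> is the type of
  nodes of the Dynkin diagram, its cardinality is the rank.\<close>

definition chevalley_generators ::
  "(complex \<Rightarrow> 'g::ab_group_add \<Rightarrow> 'g) \<Rightarrow> ('g \<Rightarrow> 'g \<Rightarrow> 'g) \<Rightarrow> 'g set
    \<Rightarrow> ('i::finite \<Rightarrow> 'i \<Rightarrow> int) \<Rightarrow> ('i \<Rightarrow> 'g) \<Rightarrow> ('i \<Rightarrow> 'g) \<Rightarrow> ('i \<Rightarrow> 'g) \<Rightarrow> bool" where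
  "chevalley_generators scale br H a h e f \<longleftrightarrow>
     cartan_matrix a \<and>
     inj h \<and> \<not> module.dependent scale (range h) \<and> module.span scale (range h) = H \<and>
     (\<forall>i j. br (h i) (h j) = 0) \<and>
     (\<forall>i j. br (h i) (e j) = scale (of_int (a i j)) (e j)) \<and>
     (\<forall>i j. br (h i) (f j) = scale (- of_int (a i j)) (f j)) \<and>
     (\<forall>i j. br (e i) (f j) = (if i = j then h i else 0)) \<and>
     (lie_subalgebra scale br hull (range e \<union> range f)) = UNIV"

text \<open>A symmetry of the Cartan matrix is the same as an automorphism of the Dynkin diagram
  (with its bonds and arrows).\<close>

definition graph_automorphism ::
  "(complex \<Rightarrow> 'g::ab_group_add \<Rightarrow> 'g) \<Rightarrow> ('g \<Rightarrow> 'g \<Rightarrow> 'g)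
    \<Rightarrow> ('i::finite \<Rightarrow> 'i \<Rightarrow> int) \<Rightarrow> ('i \<Rightarrow> 'g) \<Rightarrow> ('i \<Rightarrow> 'g) \<Rightarrow> ('i \<Rightarrow> 'g) \<Rightarrow> ('g \<Rightarrow> 'g) \<Rightarrow> bool" where
  "graph_automorphism scale br a h e f \<sigma> \<longleftrightarrow>
     lie_automorphism scale br UNIV \<sigma> \<and>
     (\<exists>\<pi>. bij \<pi> \<and> (\<forall>i j. a (\<pi> i) (\<pi> j) = a i j) \<and>
        (\<forall>i. \<sigma> (h i) = h (\<pi> i) \<and> \<sigma> (e i) = e (\<pi> i) \<and> \<sigma> (f i) = f (\<pi> i)))"

text \<open>A Chevalley automorphism is determined on the generators only up to scalars,
  $\tau(E_i) = c_i E_{-i}$, and need not commute with a graph automorphism.  The standard one,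
  $c_i = -1$, commutes with all of them.\<close>

lemma standard_chevalley_commutes:
  assumes L: "lie_algebra scale br" and G: "chevalley_generators scale br H a h e f"
    and T: "lie_automorphism scale br UNIV \<tau>" "\<And>i. \<tau> (e i) = - f i" "\<And>i. \<tau> (f i) = - e i"
    and S: "graph_automorphism scale br a h e f \<sigma>"
  shows "\<tau> \<circ> \<sigma> = \<sigma> \<circ> \<tau>"
proof -
  interpret lie_algebra scale br by (rule L)
  have S': "lie_automorphism scale br UNIV \<sigma>"
    using S by (simp add: graph_automorphism_def)
  have add: "\<tau> (x + y) = \<tau> x + \<tau> y" "\<sigma> (x + y) = \<sigma> x + \<sigma> y" for x y
    using T(1) S' by (auto simp: lie_automorphism_def)
  have sc: "\<tau> (scale c x) = scale c (\<tau> x)" "\<sigma> (scale c x) = scale c (\<sigma> x)" for c x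
    using T(1) S' by (auto simp: lie_automorphism_def)
  have br: "\<tau> (br x y) = br (\<tau> x) (\<tau> y)" "\<sigma> (br x y) = br (\<sigma> x) (\<sigma> y)" for x y
    using T(1) S' by (auto simp: lie_automorphism_def)
  have zero: "\<tau> 0 = 0" "\<sigma> 0 = 0" using add(1)[of 0 0] add(2)[of 0 0] by auto
  have neg: "\<sigma> (- x) = - \<sigma> x" for x
    using add(2)[of x "- x"] zero by (simp add: eq_neg_iff_add_eq_0 add.commute)
  let ?K = "{x. \<tau> (\<sigma> x) = \<sigma> (\<tau> x)}"
  have "lie_subalgebra scale br ?K"
    unfolding lie_subalgebra_def by (auto intro!: subspaceI simp: add sc br zero)
  moreover have "range e \<union> range f \<subseteq> ?K"
    using S T(2,3) by (auto simp: graph_automorphism_def neg)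
  ultimately have "(lie_subalgebra scale br hull (range e \<union> range f)) \<subseteq> ?K"
    by (intro hull_minimal)
  then show ?thesis using G by (auto simp: chevalley_generators_def fun_eq_iff)
qed

section \<open>The complexification of an abelian group\<close>

text \<open>$\mathbb C \otimes_{\mathbb Z} \Lambda$ is the vector space on symbols
  $[\lambda]$, $\lambda \in \Lambda$, modulo the relations
  $[\lambda + \gamma] = [\lambda] + [\gamma]$; the symbol $[\lambda]$ stands for $1 \otimes \lambda$.\<close>

definition pm_scale :: "(complex \<Rightarrow> 'g \<Rightarrow> 'g) \<Rightarrow> complex \<Rightarrow> ('l \<Rightarrow>\<^sub>0 'g::ab_group_add) \<Rightarrow> ('l \<Rightarrow>\<^sub>0 'g)" where
  "pm_scale scale c = Poly_Mapping.map (scale c)"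

lemma vector_space_pm_scale:
  assumes "vector_space scale"
  shows "vector_space (pm_scale scale)"
proof -
  interpret vector_space scale by fact
  show ?thesis
    by unfold_locales
      (auto intro!: poly_mapping_eqI
        simp: pm_scale_def Poly_Mapping.map.rep_eq when_def lookup_add scale_right_distrib
          scale_left_distrib simp flip: scale_right_distrib)
qed

lemma vector_space_complex: "vector_space ((*) :: complex \<Rightarrow> complex \<Rightarrow> complex)"
  by unfold_locales (auto simp: algebra_simps)

interpretation symbols: vector_space "pm_scale (*) :: complex \<Rightarrow> ('l \<Rightarrow>\<^sub>0 complex) \<Rightarrow> _"
  by (rule vector_space_pm_scale[OF vector_space_complex])

definition additivity_relations :: "('l::ab_group_add \<Rightarrow>\<^sub>0 complex) set" where
  "additivity_relations =
     symbols.span {Poly_Mapping.single (x + y) 1 - Poly_Mapping.single x 1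
       - Poly_Mapping.single y 1 |x y. True}"

lemma subspace_additivity_relations: "symbols.subspace additivity_relations"
  by (simp add: additivity_relations_def)

quotient_type (overloaded) 'l complexification = "'l::ab_group_add \<Rightarrow>\<^sub>0 complex" /
  "\<lambda>x y. x - y \<in> additivity_relations"
proof (rule equivpI)
  show "reflp (\<lambda>x y. x - y \<in> (additivity_relations :: ('l \<Rightarrow>\<^sub>0 complex) set))"
    by (auto intro!: reflpI symbols.subspace_0[OF subspace_additivity_relations])
  show "symp (\<lambda>x y. x - y \<in> (additivity_relations :: ('l \<Rightarrow>\<^sub>0 complex) set))"
    using symbols.subspace_neg[OF subspace_additivity_relations] by (fastforce intro!: sympI)
  show "transp (\<lambda>x y. x - y \<in> (additivity_relations :: ('l \<Rightarrow>\<^sub>0 complex) set))"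
    using symbols.subspace_add[OF subspace_additivity_relations] by (fastforce intro!: transpI)
qed

instantiation complexification :: (ab_group_add) ab_group_add
begin

lift_definition zero_complexification :: "'a complexification" is 0 .

lift_definition plus_complexification ::
  "'a complexification \<Rightarrow> 'a complexification \<Rightarrow> 'a complexification" is "(+)"
  using symbols.subspace_add[OF subspace_additivity_relations]
  by (fastforce simp: algebra_simps)

lift_definition uminus_complexification :: "'a complexification \<Rightarrow> 'a complexification" is uminus
  using symbols.subspace_neg[OF subspace_additivity_relations] by fastforce

lift_definition minus_complexification ::
  "'a complexification \<Rightarrow> 'a complexification \<Rightarrow> 'a complexification" is "(-)"
  using symbols.subspace_diff[OF subspace_additivity_relations]
  by (fastforce simp: algebra_simps)

instance
  by standard (transfer; simp add: algebra_simps symbols.subspace_0[OF subspace_additivity_relations])+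

end

lift_definition cx_scale :: "complex \<Rightarrow> 'l::ab_group_add complexification \<Rightarrow> 'l complexification"
  is "pm_scale (*)"
  using symbols.subspace_scale[OF subspace_additivity_relations]
  by (fastforce simp flip: symbols.scale_right_diff_distrib)

lift_definition cx_embed :: "'l::ab_group_add \<Rightarrow> 'l complexification"
  is "\<lambda>x. Poly_Mapping.single x 1" .

lemma cx_embed_add: "cx_embed (x + y) = cx_embed x + cx_embed y"
proof (transfer, goal_cases)
  case (1 x y)
  show ?case
    unfolding additivity_relations_def diff_diff_eq[symmetric]
    by (rule symbols.span_base) blast
qed

lemma vector_space_cx_scale: "vector_space cx_scale"
  by standard
    (transfer; simp add: symbols.subspace_0[OF subspace_additivity_relations]
      symbols.scale_right_distrib symbols.scale_left_distrib)+

section \<open>Quantum tori\<close>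

text \<open>Elements of $\mathcal A = \bigoplus_\lambda \mathbb C a^\lambda$ are finitely supported
  functions \<open>'l \<Rightarrow>\<^sub>0 complex\<close>, with $a^\lambda$ the function \<open>Poly_Mapping.single \<lambda> 1\<close>.\<close>

definition additive_group :: "'l::ab_group_add monoid" where
  "additive_group = \<lparr>carrier = UNIV, monoid.mult = (+), one = 0\<rparr>"

definition free_of_finite_rank :: "'l::ab_group_add itself \<Rightarrow> bool" where
  "free_of_finite_rank _ \<longleftrightarrow>
     (\<exists>n::nat. (additive_group :: 'l monoid) \<cong> free_Abelian_group {..<n})"

definition quantum_torus_cocycle :: "('l::ab_group_add \<Rightarrow> 'l \<Rightarrow> complex) \<Rightarrow> bool" where
  "quantum_torus_cocycle \<mu> \<longleftrightarrow>
     (\<forall>x y. \<mu> x y \<noteq> 0) \<and>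
     (\<forall>x y z. \<mu> x y * \<mu> (x + y) z = \<mu> x (y + z) * \<mu> y z) \<and>
     (\<forall>x y. \<mu> x y = \<mu> y x) \<and>
     (\<forall>x y. \<mu> x y = \<mu> (- x) (- y)) \<and>
     \<mu> 0 0 = 1"

definition torus_basis :: "'l \<Rightarrow> ('l \<Rightarrow>\<^sub>0 complex)" where
  "torus_basis l = Poly_Mapping.single l 1"

definition torus_mult :: "('l::ab_group_add \<Rightarrow> 'l \<Rightarrow> complex)
    \<Rightarrow> ('l \<Rightarrow>\<^sub>0 complex) \<Rightarrow> ('l \<Rightarrow>\<^sub>0 complex) \<Rightarrow> ('l \<Rightarrow>\<^sub>0 complex)" where
  "torus_mult \<mu> a b =
     (\<Sum>x\<in>Poly_Mapping.keys a. \<Sum>y\<in>Poly_Mapping.keys b.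
        Poly_Mapping.single (x + y)
          (Poly_Mapping.lookup a x * Poly_Mapping.lookup b y * \<mu> x y))"

definition torus_form :: "('l::ab_group_add \<Rightarrow> 'l \<Rightarrow> complex)
    \<Rightarrow> ('l \<Rightarrow>\<^sub>0 complex) \<Rightarrow> ('l \<Rightarrow>\<^sub>0 complex) \<Rightarrow> complex" where
  "torus_form \<mu> a b =
     (\<Sum>x\<in>Poly_Mapping.keys a. \<Sum>y\<in>Poly_Mapping.keys b.
        Poly_Mapping.lookup a x * Poly_Mapping.lookup b y * (if x = - y then \<mu> x y else 0))"

text \<open>With this cocycle on $\Lambda = \mathbb Z$ the torus is the algebra of Laurent polynomials
  in the variable $t = a^1$.\<close>

definition laurent_cocycle :: "int \<Rightarrow> int \<Rightarrow> complex" where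
  "laurent_cocycle = (\<lambda>_ _. 1)"

section \<open>Twisted loop algebras and their extensions\<close>

text \<open>$\mathfrak g \otimes \mathcal A = \bigoplus_\lambda \mathfrak g \otimes \mathbb C a^\lambda$
  is represented by \<open>'l \<Rightarrow>\<^sub>0 'g\<close>: the function \<open>u\<close> stands for
  $\sum_\lambda u(\lambda) \otimes a^\lambda$, and the degree-\<open>\<lambda>\<close> part of \<open>u\<close> is
  $u(\lambda) \otimes a^\lambda$.\<close>

definition tensor :: "(complex \<Rightarrow> 'g::ab_group_add \<Rightarrow> 'g) \<Rightarrow> 'g \<Rightarrow> ('l \<Rightarrow>\<^sub>0 complex) \<Rightarrow> ('l \<Rightarrow>\<^sub>0 'g)" where
  "tensor scale x a = Poly_Mapping.map (\<lambda>c. scale c x) a"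

definition loop_bracket ::
  "(complex \<Rightarrow> 'g::ab_group_add \<Rightarrow> 'g) \<Rightarrow> ('g \<Rightarrow> 'g \<Rightarrow> 'g) \<Rightarrow> ('l::ab_group_add \<Rightarrow> 'l \<Rightarrow> complex)
    \<Rightarrow> ('l \<Rightarrow>\<^sub>0 'g) \<Rightarrow> ('l \<Rightarrow>\<^sub>0 'g) \<Rightarrow> ('l \<Rightarrow>\<^sub>0 'g)" where
  "loop_bracket scale br \<mu> u v =
     (\<Sum>x\<in>Poly_Mapping.keys u. \<Sum>y\<in>Poly_Mapping.keys v.
        tensor scale (br (Poly_Mapping.lookup u x) (Poly_Mapping.lookup v y))
          (torus_mult \<mu> (torus_basis x) (torus_basis y)))"

definition loop_form ::
  "('g::ab_group_add \<Rightarrow> 'g \<Rightarrow> complex) \<Rightarrow> ('l::ab_group_add \<Rightarrow> 'l \<Rightarrow> complex)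
    \<Rightarrow> ('l \<Rightarrow>\<^sub>0 'g) \<Rightarrow> ('l \<Rightarrow>\<^sub>0 'g) \<Rightarrow> complex" where
  "loop_form form \<mu> u v =
     (\<Sum>x\<in>Poly_Mapping.keys u. \<Sum>y\<in>Poly_Mapping.keys v.
        form (Poly_Mapping.lookup u x) (Poly_Mapping.lookup v y)
          * torus_form \<mu> (torus_basis x) (torus_basis y))"

text \<open>The class of $j$ in $\mathbb Z_m$ is given by any integer representative.\<close>

definition eigenspace ::
  "(complex \<Rightarrow> 'g::ab_group_add \<Rightarrow> 'g) \<Rightarrow> ('g \<Rightarrow> 'g) \<Rightarrow> nat \<Rightarrow> int \<Rightarrow> 'g set" where
  "eigenspace scale \<sigma> m j =
     {x. \<sigma> x = scale (exp (2 * complex_of_real pi * \<i> / of_nat m) powi j) x}"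

definition twisted_loop ::
  "(complex \<Rightarrow> 'g::ab_group_add \<Rightarrow> 'g) \<Rightarrow> ('g \<Rightarrow> 'g) \<Rightarrow> nat \<Rightarrow> ('l \<Rightarrow> int) \<Rightarrow> ('l \<Rightarrow>\<^sub>0 'g) set" where
  "twisted_loop scale \<sigma> m \<rho> =
     {u. \<forall>l. Poly_Mapping.lookup u l \<in> eigenspace scale \<sigma> m (\<rho> l)}"

text \<open>A triple \<open>(u, v, d)\<close> is $u + v + d$ with $u$ in the twisted loop algebra,
  $v \in \mathcal V = \mathbb C \otimes \Lambda$ and $d \in \mathcal V^\star$.\<close>

type_synonym ('l, 'g) extended_loop =
  "('l \<Rightarrow>\<^sub>0 'g) \<times> 'l complexification \<times> ('l complexification \<Rightarrow> complex)"

definition dual_space :: "('l::ab_group_add complexification \<Rightarrow> complex) set" where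
  "dual_space = {d. Vector_Spaces.linear cx_scale (*) d}"

definition extended_twisted_loop ::
  "(complex \<Rightarrow> 'g::ab_group_add \<Rightarrow> 'g) \<Rightarrow> ('g \<Rightarrow> 'g) \<Rightarrow> nat \<Rightarrow> ('l::ab_group_add \<Rightarrow> int)
    \<Rightarrow> ('l, 'g) extended_loop set" where
  "extended_twisted_loop scale \<sigma> m \<rho> = twisted_loop scale \<sigma> m \<rho> \<times> UNIV \<times> dual_space"

definition extended_scale ::
  "(complex \<Rightarrow> 'g::ab_group_add \<Rightarrow> 'g) \<Rightarrow> complex
    \<Rightarrow> ('l::ab_group_add, 'g) extended_loop \<Rightarrow> ('l, 'g) extended_loop" where
  "extended_scale scale c =
     (\<lambda>(u, v, d). (pm_scale scale c u, cx_scale c v, (\<lambda>x. c * d x)))"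

text \<open>$[d, u]$ for $d \in \mathcal V^\star$.\<close>

definition degree_derivation ::
  "(complex \<Rightarrow> 'g::ab_group_add \<Rightarrow> 'g) \<Rightarrow> ('l::ab_group_add complexification \<Rightarrow> complex)
    \<Rightarrow> ('l \<Rightarrow>\<^sub>0 'g) \<Rightarrow> ('l \<Rightarrow>\<^sub>0 'g)" where
  "degree_derivation scale d u =
     (\<Sum>l\<in>Poly_Mapping.keys u.
        Poly_Mapping.single l (scale (d (cx_embed l)) (Poly_Mapping.lookup u l)))"

text \<open>The component of $[u, u']$ in $\mathcal V$: the sum of $(u_\lambda, u')\,\lambda$ over the
  homogeneous parts $u_\lambda$ of $u$.\<close>

definition central_part ::
  "('g::ab_group_add \<Rightarrow> 'g \<Rightarrow> complex) \<Rightarrow> ('l::ab_group_add \<Rightarrow> 'l \<Rightarrow> complex)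
    \<Rightarrow> ('l \<Rightarrow>\<^sub>0 'g) \<Rightarrow> ('l \<Rightarrow>\<^sub>0 'g) \<Rightarrow> 'l complexification" where
  "central_part form \<mu> u u' =
     (\<Sum>l\<in>Poly_Mapping.keys u.
        cx_scale (loop_form form \<mu> (Poly_Mapping.single l (Poly_Mapping.lookup u l)) u')
          (cx_embed l))"

definition extended_bracket ::
  "(complex \<Rightarrow> 'g::ab_group_add \<Rightarrow> 'g) \<Rightarrow> ('g \<Rightarrow> 'g \<Rightarrow> 'g) \<Rightarrow> ('g \<Rightarrow> 'g \<Rightarrow> complex)
    \<Rightarrow> ('l::ab_group_add \<Rightarrow> 'l \<Rightarrow> complex)
    \<Rightarrow> ('l, 'g) extended_loop \<Rightarrow> ('l, 'g) extended_loop \<Rightarrow> ('l, 'g) extended_loop" where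
  "extended_bracket scale br form \<mu> =
     (\<lambda>(u, v, d) (u', v', d').
        (loop_bracket scale br \<mu> u u' + degree_derivation scale d u' - degree_derivation scale d' u,
         central_part form \<mu> u u',
         0))"

definition extended_cartan ::
  "(complex \<Rightarrow> 'g::ab_group_add \<Rightarrow> 'g) \<Rightarrow> 'g set \<Rightarrow> ('g \<Rightarrow> 'g)
    \<Rightarrow> ('l::ab_group_add, 'g) extended_loop set" where
  "extended_cartan scale H \<sigma> =
     {tensor scale x (torus_basis 0) |x. x \<in> H \<and> \<sigma> x = x} \<times> UNIV \<times> dual_space"

definition bar_map ::
  "('g::ab_group_add \<Rightarrow> 'g) \<Rightarrow> ('g \<Rightarrow> 'g) \<Rightarrow> ('l::ab_group_add, 'g) extended_loop \<Rightarrow> ('l, 'g) extended_loop"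
  where
  "bar_map \<psi> \<tau> =
     (\<lambda>(u, v, d).
        (\<Sum>l\<in>Poly_Mapping.keys u. Poly_Mapping.single (- l) (\<psi> (\<tau> (Poly_Mapping.lookup u l))),
         - v, - d))"

end

theory Submission
  imports Defs "HOL-Analysis.Cartesian_Space"
begin

text \<open>The bar map of \<open>\<theta> = \<psi>\<tau>\<close> is a Chevalley automorphism as soon as \<open>\<theta>\<close> is an automorphism of finite
  order that preserves the form, maps the \<open>\<sigma>\<close>-eigenspaces of degree \<open>j\<close> to those of degree \<open>- j\<close>
  and is \<open>- id\<close> on $\mathfrak h^\sigma$.  For \<open>\<sigma>\<close> of order 2 this is clear for \<open>\<theta> = \<tau>\<close>.  Otherwise
  the diagram is $D_4$, \<open>\<sigma>\<close> rotates its three legs and \<open>\<psi>\<close> exchanges two of them, so that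
  \<open>\<psi>\<close> conjugates \<open>\<sigma>\<close> to its inverse and preserves the orbits of \<open>\<sigma>\<close> on the nodes.

  To find $D_4$, let \<open>w\<close> be the coefficient vector of $2\rho^\vee$ in the simple coroots.  It is
  strictly superharmonic on the diagram, so every node has at most one neighbour with at least its
  own weight.  This makes the diagram a rooted tree compatible with all its automorphisms, on which
  positive definiteness is a simple inequality.

  Invariance of the form needs only be checked on the Cartan subalgebra: an invariant form vanishing
  there has the coroots in its radical, which is an ideal.\<close>

section \<open>Cartan matrices\<close>

lemma cartan_matrix_diag: "cartan_matrix a \<Longrightarrow> a i i = 2"
  by (simp add: cartan_matrix_def)

lemma cartan_matrix_nonpos: "cartan_matrix a \<Longrightarrow> i \<noteq> j \<Longrightarrow> a i j \<le> 0"
  by (simp add: cartan_matrix_def)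

lemma cartan_matrix_zero_sym: "cartan_matrix a \<Longrightarrow> a i j = 0 \<Longrightarrow> a j i = 0"
  by (simp add: cartan_matrix_def)

lemma cartan_matrix_symmetrizer:
  fixes a :: "'i::finite \<Rightarrow> 'i \<Rightarrow> int"
  assumes "cartan_matrix a"
  obtains d :: "'i \<Rightarrow> real" where "\<forall>i. d i > 0"
    "\<forall>i j. d i * of_int (a i j) = d j * of_int (a j i)"
    "\<forall>v. (\<Sum>i\<in>UNIV. \<Sum>j\<in>UNIV. d i * of_int (a i j) * v i * v j) \<le> 0 \<longrightarrow> v = (\<lambda>_. 0)"
proof -
  obtain d :: "'i \<Rightarrow> real" where "\<forall>i. d i > 0"
    "\<forall>i j. d i * of_int (a i j) = d j * of_int (a j i)"
    and P: "\<forall>v::'i \<Rightarrow> real. (\<exists>i. v i \<noteq> 0) \<longrightarrow>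
           (\<Sum>i\<in>UNIV. \<Sum>j\<in>UNIV. d i * of_int (a i j) * v i * v j) > 0"
    using assms unfolding cartan_matrix_def by blast
  moreover from P have "\<forall>v. (\<Sum>i\<in>UNIV. \<Sum>j\<in>UNIV. d i * of_int (a i j) * v i * v j) \<le> 0 \<longrightarrow> v = (\<lambda>_. 0)"
    by (auto simp: fun_eq_iff not_less[symmetric])
  ultimately show ?thesis using that[of d] by blast
qed

text \<open>Inverse positivity, by testing the quadratic form on the negative part of
  \<open>v\<close>. Off-diagonal entries are nonpositive, so the value there is at most minus the
  pairing of that nonnegative part with \<open>v\<close> times \<open>a\<close>; it is nonpositive,
  and the negative part vanishes.\<close>

lemma cartan_matrix_left_nonneg:
  fixes v :: "'i::finite \<Rightarrow> real"
  assumes a: "cartan_matrix a" and v: "\<And>j. (\<Sum>i\<in>UNIV. v i * of_int (a i j)) \<ge> 0"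
  shows "v i \<ge> 0"
proof -
  obtain d :: "'i \<Rightarrow> real" where d: "\<forall>i. d i > 0"
    and "\<forall>i j. d i * of_int (a i j) = d j * of_int (a j i)"
    and P: "\<forall>v. (\<Sum>i\<in>UNIV. \<Sum>j\<in>UNIV. d i * of_int (a i j) * v i * v j) \<le> 0 \<longrightarrow> v = (\<lambda>_. 0)"
    using cartan_matrix_symmetrizer[OF a] by blast
  \<comment> \<open>Dividing by \<open>d i\<close> cancels the symmetrizer: \<open>d i * n i\<close>
    is the negative part of \<open>v i\<close>.\<close>
  define n where "n = (\<lambda>i. max 0 (- v i / d i))"
  have vi: "d i * n i = max 0 (- v i)" for i
    using d[rule_format, of i] by (auto simp: n_def max_def field_simps)
  have n0: "n j \<ge> 0" for j by (simp add: n_def)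
  \<comment> \<open>Equality on the diagonal; elsewhere the difference of the two sides is the
    positive part of \<open>v i\<close> times \<open>n j * a i j\<close>, which is at most
    0.\<close>
  have "d i * of_int (a i j) * n i * n j \<le> - (n j * (v i * of_int (a i j)))" for i j
  proof (cases "i = j")
    case True
    have "n i * (d i * n i) = n i * - v i"
      using d[rule_format, of i] by (auto simp: vi) (auto simp: n_def max_def field_simps)
    then show ?thesis using True cartan_matrix_diag[OF a] by (simp add: algebra_simps)
  next
    case False
    then have "of_int (a i j) \<le> (0::real)" using cartan_matrix_nonpos[OF a] by simp
    moreover have "d i * n i + v i \<ge> 0" by (simp add: vi)
    ultimately have "(d i * n i + v i) * n j * of_int (a i j) \<le> 0"
      using n0 by (intro mult_nonneg_nonpos) auto
    then show ?thesis by (simp add: algebra_simps)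
  qed
  then have "(\<Sum>i\<in>UNIV. \<Sum>j\<in>UNIV. d i * of_int (a i j) * n i * n j)
    \<le> (\<Sum>i\<in>UNIV. \<Sum>j\<in>UNIV. - (n j * (v i * of_int (a i j))))"
    by (intro sum_mono)
  also have "\<dots> = - (\<Sum>j\<in>UNIV. n j * (\<Sum>i\<in>UNIV. v i * of_int (a i j)))"
    by (subst sum.swap) (simp add: sum_negf sum_distrib_left)
  also have "\<dots> \<le> 0" using v n0 by (simp add: sum_nonneg)
  finally have "n = (\<lambda>_. 0)" using P by blast
  then show ?thesis using vi[of i] by (simp add: max_def split: if_splits)
qed

lemma cartan_matrix_left_kernel:
  fixes v :: "'i::finite \<Rightarrow> real"
  assumes a: "cartan_matrix a" and v: "\<And>j. (\<Sum>i\<in>UNIV. v i * of_int (a i j)) = 0"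
  shows "v i = 0"
  using cartan_matrix_left_nonneg[OF a, of v i] cartan_matrix_left_nonneg[OF a, of "\<lambda>i. - v i" i] v
  by (simp add: sum_negf)

text \<open>The left kernel is trivial, so the left action on \<open>real ^ 'i\<close> is injective
  and hence onto.\<close>

lemma cartan_matrix_left_surj:
  fixes y :: "'i::finite \<Rightarrow> real"
  assumes a: "cartan_matrix a"
  shows "\<exists>w. \<forall>j. (\<Sum>i\<in>UNIV. w i * of_int (a i j)) = y j"
proof -
  define T :: "real ^ 'i \<Rightarrow> real ^ 'i" where "T v = (\<chi> j. \<Sum>i\<in>UNIV. v $ i * of_int (a i j))" for v
  have "linear T"
    by (rule linearI)
      (auto simp: T_def vec_eq_iff algebra_simps sum.distrib sum_distrib_left)
  moreover have "inj T"
  proof (subst linear_injective_0[OF \<open>linear T\<close>], intro allI impI)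
    fix v assume "T v = 0"
    then have "v $ i = 0" for i
      using cartan_matrix_left_kernel[OF a, of "\<lambda>i. v $ i"] by (simp add: T_def vec_eq_iff)
    then show "v = 0" by (simp add: vec_eq_iff)
  qed
  ultimately have "surj T" by (rule linear_injective_imp_surjective) simp
  then obtain v where "T v = (\<chi> j. y j)" by (metis surjD)
  then show ?thesis by (intro exI[of _ "\<lambda>i. v $ i"]) (simp add: T_def vec_eq_iff)
qed

text \<open>The coefficients of twice the sum of the fundamental coweights in the basis of simple coroots.\<close>

definition principal_weight :: "('i::finite \<Rightarrow> 'i \<Rightarrow> int) \<Rightarrow> 'i \<Rightarrow> real" where
  "principal_weight a = (SOME w. \<forall>j. (\<Sum>i\<in>UNIV. w i * of_int (a i j)) = 2)"

lemma principal_weight_eq: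
  assumes "cartan_matrix a"
  shows "(\<Sum>i\<in>UNIV. principal_weight a i * of_int (a i j)) = 2"
  using someI_ex[OF cartan_matrix_left_surj[OF assms, of "\<lambda>_. 2"]]
  by (simp add: principal_weight_def)

lemma principal_weight_nonneg: "cartan_matrix a \<Longrightarrow> principal_weight a i \<ge> 0"
  by (rule cartan_matrix_left_nonneg) (auto simp: principal_weight_eq)

definition diagram_automorphism :: "('i \<Rightarrow> 'i \<Rightarrow> int) \<Rightarrow> ('i \<Rightarrow> 'i) \<Rightarrow> bool" where
  "diagram_automorphism a \<pi> \<longleftrightarrow> bij \<pi> \<and> (\<forall>i j. a (\<pi> i) (\<pi> j) = a i j)"

text \<open>The permuted weight solves the same linear system, and the left kernel is
  trivial.\<close>

lemma principal_weight_automorphism: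
  assumes a: "cartan_matrix a" and \<pi>: "diagram_automorphism a \<pi>"
  shows "principal_weight a (\<pi> i) = principal_weight a i"
proof -
  let ?w = "principal_weight a"
  have "(\<Sum>i\<in>UNIV. ?w (\<pi> i) * of_int (a i j)) = (\<Sum>i\<in>UNIV. ?w i * of_int (a i (\<pi> j)))" for j
    using sum.reindex_bij_betw[of \<pi> UNIV UNIV "\<lambda>i. ?w i * of_int (a i (\<pi> j))"] \<pi>
    by (simp add: diagram_automorphism_def)
  then have "?w (\<pi> i) - ?w i = 0"
    using cartan_matrix_left_kernel[OF a, of "\<lambda>i. ?w (\<pi> i) - ?w i" i]
    by (simp add: left_diff_distrib sum_subtractf principal_weight_eq[OF a])
  then show ?thesis by simp
qed

section \<open>Connected Dynkin diagrams as rooted trees\<close>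

locale connected_dynkin =
  fixes a :: "'i::finite \<Rightarrow> 'i \<Rightarrow> int"
  assumes cartan: "cartan_matrix a"
    and connected: "\<lbrakk>S \<noteq> {}; \<And>i j. i \<in> S \<Longrightarrow> a i j \<noteq> 0 \<Longrightarrow> j \<in> S\<rbrakk> \<Longrightarrow> S = UNIV"
begin

abbreviation "w \<equiv> principal_weight a"

definition adj :: "'i \<Rightarrow> 'i \<Rightarrow> bool" where "adj i j \<longleftrightarrow> i \<noteq> j \<and> a i j \<noteq> 0"

lemma adj_sym: "adj i j \<Longrightarrow> adj j i"
  using cartan_matrix_zero_sym[OF cartan] by (auto simp: adj_def)

text \<open>Since \<open>2 w\<^sub>j = 2 + \<Sum>\<^sub>i \<bar>a\<^sub>i\<^sub>j\<bar> w\<^sub>i\<close> over the neighbours \<open>i\<close> of \<open>j\<close>, two of them cannot both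
  reach \<open>w\<^sub>j\<close>.\<close>

lemma upper_neighbour_unique:
  assumes "adj j i" "adj j k" "w j \<le> w i" "w j \<le> w k"
  shows "i = k"
proof (rule ccontr)
  assume ik: "i \<noteq> k"
  have ne: "i \<noteq> j" "k \<noteq> j" using assms by (auto simp: adj_def)
  have neg: "w x * of_int (a x j) \<le> 0" if "x \<noteq> j" for x
    using cartan_matrix_nonpos[OF cartan that] principal_weight_nonneg[OF cartan]
    by (intro mult_nonneg_nonpos) auto
  have le: "w x * of_int (a x j) \<le> - w x" if "adj j x" for x
  proof -
    have "a x j \<le> -1"
      using adj_sym[OF that] cartan_matrix_nonpos[OF cartan, of x j] by (auto simp: adj_def)
    then have "w x * of_int (a x j) \<le> w x * -1"
      using principal_weight_nonneg[OF cartan, of x] by (intro mult_left_mono) linarith+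
    then show ?thesis by simp
  qed
  have "2 = (\<Sum>x\<in>UNIV. w x * of_int (a x j))" by (simp add: principal_weight_eq[OF cartan])
  also have "\<dots> = w j * 2 + (w i * of_int (a i j) + (w k * of_int (a k j)
      + (\<Sum>x\<in>UNIV - {j} - {i} - {k}. w x * of_int (a x j))))"
    using ik ne cartan_matrix_diag[OF cartan, of j]
    by (simp add: sum.remove[of UNIV j] sum.remove[of "UNIV - {j}" i]
        sum.remove[of "UNIV - {j} - {i}" k])
  also have "\<dots> \<le> w j * 2 + (- w i + (- w k + 0))"
    using assms neg by (intro add_mono le sum_nonpos order_refl) auto
  finally show False using assms by simp
qed

text \<open>In type A of even rank two nodes attain the maximum and \<open>SOME\<close> selects one
  of them; this is why ties of weights next to \<open>root\<close> are treated separately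
  below.\<close>

definition root :: 'i where "root = (SOME b. \<forall>x. w x \<le> w b)"

lemma w_le_root: "w x \<le> w root"
proof -
  obtain b where "is_arg_min (\<lambda>x. - w x) (\<lambda>_. True) b"
    using ex_is_arg_min_if_finite[of UNIV "\<lambda>x. - w x"] by auto
  then have "\<exists>b. \<forall>x. w x \<le> w b" by (auto simp: is_arg_min_def not_less)
  from someI_ex[OF this] show ?thesis by (simp add: root_def)
qed

text \<open>The nodes with a weakly ascending path to \<open>root\<close> are closed under
  adjacency, hence all nodes. If a step from \<open>x\<close> to \<open>y \<noteq> root\<close> is a
  tie, uniqueness of the upper neighbour sends the ascent from \<open>y\<close> back to
  \<open>x\<close>, which forces \<open>x = root\<close>.\<close>

lemma ex_parent: "x = root \<or> (\<exists>y. adj x y \<and> w x \<le> w y \<and> (y = root \<or> w x < w y))"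
proof -
  define up where "up = (\<lambda>x y. adj x y \<and> w x \<le> w y)"
  define R where "R = {x. up\<^sup>*\<^sup>* x root}"
  have "root \<in> R" by (simp add: R_def)
  \<comment> \<open>If \<open>x\<close> is the heavier end, it is the only upper neighbour of
    \<open>y\<close>, so the path from \<open>y\<close> to \<open>root\<close> starts with
    \<open>x\<close>.\<close>
  moreover have "x \<in> R" if "y \<in> R" "adj y x" for x y
  proof (cases "w x \<le> w y")
    case True
    then show ?thesis using that adj_sym[OF that(2)]
      by (auto simp: R_def up_def intro: converse_rtranclp_into_rtranclp)
  next
    case False
    then have "y \<noteq> root" using w_le_root[of x] by auto
    with \<open>y \<in> R\<close> obtain z where z: "up y z" "z \<in> R"
      by (auto simp: R_def elim: converse_rtranclpE)
    then have "x = z"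
      using upper_neighbour_unique[of y x z] that False by (auto simp: up_def)
    with z show ?thesis by simp
  qed
  ultimately have "R = UNIV"
    using cartan_matrix_diag[OF cartan] by (intro connected) (auto simp: adj_def, metis)
  then have "up\<^sup>*\<^sup>* x root" by (auto simp: R_def)
  then show ?thesis
  proof (induction rule: converse_rtranclp_induct)
    case (step x y)
    show ?case
    proof (cases "w x < w y \<or> y = root")
      case False
      then obtain z where z: "adj y z" "w y \<le> w z" "z = root \<or> w y < w z"
        using step.IH by auto
      then have "z = x"
        using upper_neighbour_unique[of y z x] step(1) False adj_sym by (auto simp: up_def)
      with z False show ?thesis using step(1) by (auto simp: up_def)
    qed (use step(1) in \<open>auto simp: up_def\<close>)
  qed simp
qed

text \<open>The tree edges are the pairs \<open>x\<close>, \<open>parent x\<close> with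
  \<open>x \<noteq> root\<close>; sums over edges therefore leave out the root.\<close>

definition parent :: "'i \<Rightarrow> 'i" where
  "parent x = (SOME y. adj x y \<and> w x \<le> w y \<and> (y = root \<or> w x < w y))"

lemma parent:
  assumes "x \<noteq> root"
  shows "adj x (parent x)" "w x \<le> w (parent x)" "parent x = root \<or> w x < w (parent x)"
  using someI_ex[of "\<lambda>y. adj x y \<and> w x \<le> w y \<and> (y = root \<or> w x < w y)"] ex_parent[of x] assms
  unfolding parent_def by auto

lemma parent_eqI: "x \<noteq> root \<Longrightarrow> adj x y \<Longrightarrow> w x \<le> w y \<Longrightarrow> parent x = y"
  using upper_neighbour_unique parent by blast

text \<open>Weights grow strictly below the root, so no edge is counted from both of its
  ends.\<close>

lemma parent_antisym: "x \<noteq> root \<Longrightarrow> y \<noteq> root \<Longrightarrow> parent x = y \<Longrightarrow> parent y \<noteq> x"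
  using parent[of x] parent[of y] by fastforce

text \<open>Normalising the simple roots to unit vectors, adjacent ones have inner product at most
  \<open>- 1/2\<close>.\<close>

lemma tree_inequality:
  fixes v :: "'i \<Rightarrow> real"
  assumes v: "\<And>x. v x \<ge> 0" and v0: "v y \<noteq> 0"
  shows "(\<Sum>x\<in>UNIV - {root}. v x * v (parent x)) < (\<Sum>x\<in>UNIV. (v x)\<^sup>2)"
proof -
  obtain d :: "'i \<Rightarrow> real" where d: "\<forall>i. d i > 0"
    and sym: "\<forall>i j. d i * of_int (a i j) = d j * of_int (a j i)"
    and P: "\<forall>v. (\<Sum>i\<in>UNIV. \<Sum>j\<in>UNIV. d i * of_int (a i j) * v i * v j) \<le> 0 \<longrightarrow> v = (\<lambda>_. 0)"
    using cartan_matrix_symmetrizer[OF cartan] by blast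
  \<comment> \<open>This rescaling turns the diagonal terms into
    \<open>2 * (v x)\<^sup>2\<close>.\<close>
  define u where "u x = v x / sqrt (d x)" for x
  define C where "C x y = d x * of_int (a x y) * u x * u y" for x y
  define p where "p x y = (if x \<noteq> root \<and> y = parent x then v x * v y else 0)" for x y
  have u: "u x \<ge> 0" for x using v d by (simp add: u_def less_imp_le)
  have C_adj: "C x y \<le> - (v x * v y)" if "adj x y" for x y
  proof -
    have neg: "a x y \<le> -1" "a y x \<le> -1"
      using that adj_sym[OF that] cartan_matrix_nonpos[OF cartan, of x y]
        cartan_matrix_nonpos[OF cartan, of y x] by (auto simp: adj_def)
    \<comment> \<open>Two negative integers have product at least 1; the symmetrizer turns this into
      a lower bound for the square of \<open>d x * a x y\<close>.\<close>
    have "1 * 1 \<le> (- of_int (a x y)) * (- of_int (a y x) :: real)"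
      using neg by (intro mult_mono) linarith+
    then have "d x * d y * 1 \<le> d x * d y * (of_int (a x y) * of_int (a y x))"
      using d by (intro mult_left_mono) (auto simp: less_imp_le)
    also have "\<dots> = (- (d x * of_int (a x y)))\<^sup>2"
      using sym[rule_format, of x y] by (simp add: power2_eq_square algebra_simps)
    finally have "sqrt (d x * d y) \<le> \<bar>- (d x * of_int (a x y))\<bar>"
      by (metis mult.right_neutral real_sqrt_abs real_sqrt_le_iff)
    also have "\<dots> = - (d x * of_int (a x y))"
      using neg d[rule_format, of x] by (intro abs_of_nonneg) (simp add: mult_nonneg_nonpos less_imp_le)
    finally have "sqrt (d x) * sqrt (d y) * (u x * u y) \<le> - (d x * of_int (a x y)) * (u x * u y)"
      using u by (intro mult_right_mono) (auto simp: real_sqrt_mult)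
    moreover have "sqrt (d x) * sqrt (d y) * (u x * u y) = v x * v y"
      using d[rule_format, of x] d[rule_format, of y] by (simp add: u_def)
    ultimately show ?thesis by (simp add: C_def)
  qed
  \<comment> \<open>Each edge occurs as two ordered pairs, hence both \<open>p x y\<close> and
    \<open>p y x\<close>; at most one of these is nonzero.\<close>
  have "C x y \<le> (if x = y then 2 * (v x)\<^sup>2 else 0) - p x y - p y x" for x y
  proof (cases "x = y")
    case True
    have "C x x = 2 * (v x)\<^sup>2"
      using d[rule_format, of x] cartan_matrix_diag[OF cartan, of x] by (simp add: C_def u_def power2_eq_square)
    moreover have "p x x = 0" using parent(1)[of x] by (auto simp: p_def adj_def)
    ultimately show ?thesis using True by simp
  next
    case False
    have "C x y \<le> 0"
      using cartan_matrix_nonpos[OF cartan False] d[rule_format, of x] u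
      by (auto simp: C_def mult_nonneg_nonpos mult_nonpos_nonneg less_imp_le)
    moreover have "adj x y" if "p x y \<noteq> 0 \<or> p y x \<noteq> 0"
      using that parent(1) adj_sym by (auto simp: p_def split: if_splits)
    moreover have "p x y = 0 \<or> p y x = 0"
      using parent_antisym[of x y] unfolding p_def by auto
    moreover have "p x y \<in> {0, v x * v y}" "p y x \<in> {0, v x * v y}" by (auto simp: p_def)
    ultimately show ?thesis using False C_adj[of x y]
      by (cases "v x * v y = 0") auto
  qed
  then have "(\<Sum>x\<in>UNIV. \<Sum>y\<in>UNIV. C x y)
      \<le> (\<Sum>x\<in>UNIV. \<Sum>y\<in>UNIV. (if x = y then 2 * (v x)\<^sup>2 else 0) - p x y - p y x)"
    by (intro sum_mono)
  also have "\<dots> = 2 * (\<Sum>x\<in>UNIV. (v x)\<^sup>2) - (\<Sum>x\<in>UNIV. \<Sum>y\<in>UNIV. p x y)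
      - (\<Sum>x\<in>UNIV. \<Sum>y\<in>UNIV. p y x)"
    by (simp add: sum_subtractf sum_distrib_left)
  also have "(\<Sum>x\<in>UNIV. \<Sum>y\<in>UNIV. p y x) = (\<Sum>x\<in>UNIV. \<Sum>y\<in>UNIV. p x y)" by (rule sum.swap)
  also have "(\<Sum>x\<in>UNIV. \<Sum>y\<in>UNIV. p x y) = (\<Sum>x\<in>UNIV. if x \<noteq> root then v x * v (parent x) else 0)"
    by (intro sum.cong refl) (auto simp: p_def)
  also have "\<dots> = (\<Sum>x\<in>UNIV - {root}. v x * v (parent x))"
    by (simp add: sum.If_cases Collect_neg_eq Compl_eq_Diff_UNIV)
  finally have "(\<Sum>x\<in>UNIV. \<Sum>y\<in>UNIV. C x y)
      \<le> 2 * (\<Sum>x\<in>UNIV. (v x)\<^sup>2) - 2 * (\<Sum>x\<in>UNIV - {root}. v x * v (parent x))" by simp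
  moreover have "u y \<noteq> 0" using v0 d[rule_format, of y] by (simp add: u_def)
  then have "\<not> (\<Sum>x\<in>UNIV. \<Sum>y\<in>UNIV. C x y) \<le> 0"
    using P[rule_format, of u] by (auto simp: C_def)
  ultimately show ?thesis by linarith
qed

section \<open>Diagram automorphisms of the rooted tree and test vectors\<close>

lemma adj_automorphism: "diagram_automorphism a \<pi> \<Longrightarrow> adj (\<pi> x) (\<pi> y) \<longleftrightarrow> adj x y"
  by (auto simp: adj_def diagram_automorphism_def bij_def inj_eq)

lemma automorphism_eq_iff: "diagram_automorphism a \<pi> \<Longrightarrow> \<pi> x = \<pi> y \<longleftrightarrow> x = y"
  by (auto simp: diagram_automorphism_def bij_def inj_eq)

text \<open>Adaptation to test vectors, with edges indexed by their lower end: omitted edges have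
  nonnegative terms, and nodes outside \<open>S'\<close> contribute nothing.\<close>

lemma tree_inequality_on:
  fixes v :: "'i \<Rightarrow> real"
  assumes v: "\<And>x. v x \<ge> 0" and v0: "v y \<noteq> 0" and "root \<notin> S" and "\<And>x. x \<notin> S' \<Longrightarrow> v x = 0"
  shows "(\<Sum>x\<in>S. v x * v (parent x)) < (\<Sum>x\<in>S'. (v x)\<^sup>2)"
proof -
  have "(\<Sum>x\<in>S. v x * v (parent x)) \<le> (\<Sum>x\<in>UNIV - {root}. v x * v (parent x))"
    using assms by (intro sum_mono2) auto
  also have "\<dots> < (\<Sum>x\<in>UNIV. (v x)\<^sup>2)" using tree_inequality[of v y] v v0 by blast
  also have "\<dots> = (\<Sum>x\<in>S'. (v x)\<^sup>2)"
    using assms by (intro sum.mono_neutral_right) auto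
  finally show ?thesis .
qed

lemma w_automorphism: "diagram_automorphism a \<pi> \<Longrightarrow> w (\<pi> x) = w x"
  by (rule principal_weight_automorphism[OF cartan])

text \<open>The strict bound keeps \<open>\<pi> x\<close> away from \<open>root\<close>, which an
  automorphism may exchange with another node of maximal weight.\<close>

lemma parent_automorphism:
  assumes \<pi>: "diagram_automorphism a \<pi>" and x: "w x < w root"
  shows "parent (\<pi> x) = \<pi> (parent x)"
proof (rule parent_eqI)
  show "\<pi> x \<noteq> root" using w_automorphism[OF \<pi>, of x] x by auto
  show "adj (\<pi> x) (\<pi> (parent x))" "w (\<pi> x) \<le> w (\<pi> (parent x))"
    using parent[of x] x by (auto simp: adj_automorphism[OF \<pi>] w_automorphism[OF \<pi>])
qed

lemma ex_max_w: "x \<in> A \<Longrightarrow> \<exists>y\<in>A. \<forall>z\<in>A. w z \<le> w y"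
  using ex_is_arg_min_if_finite[of A "\<lambda>x. - w x"] by (fastforce simp: is_arg_min_def not_less)

text \<open>The vectors \<open>v\<close> below are null vectors of the affine diagrams $\tilde D_n$ and
  $\tilde E_6$; only $D_4$ escapes them.\<close>

theorem triality:
  assumes \<pi>: "diagram_automorphism a \<pi>" and "\<pi> \<circ> \<pi> \<noteq> id"
  obtains i where "\<And>x. x \<in> {root, i, \<pi> i, \<pi> (\<pi> i)}" "distinct [root, i, \<pi> i, \<pi> (\<pi> i)]"
    "\<pi> (\<pi> (\<pi> i)) = i" "\<And>x. adj root x \<longleftrightarrow> x \<noteq> root"
    "\<And>g. diagram_automorphism a g \<Longrightarrow> g root = root"
proof -
  note [simp] = automorphism_eq_iff[OF \<pi>] w_automorphism[OF \<pi>]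
  \<comment> \<open>Maximality of \<open>w i\<close> makes every heavier node fixed by
    \<open>\<pi> \<circ> \<pi>\<close>.\<close>
  obtain i where i: "\<pi> (\<pi> i) \<noteq> i" and max: "\<And>x. \<pi> (\<pi> x) \<noteq> x \<Longrightarrow> w x \<le> w i"
    using assms(2) ex_max_w[of _ "{x. \<pi> (\<pi> x) \<noteq> x}"] by (auto simp: fun_eq_iff)
  have ne: "\<pi> i \<noteq> i" using i by auto
  \<comment> \<open>Nodes of maximal weight other than \<open>root\<close> are upper neighbours of
    \<open>root\<close>, so there is at most one of them; but \<open>i\<close>,
    \<open>\<pi> i\<close> and \<open>\<pi> (\<pi> i)\<close> would be three distinct nodes of
    maximal weight.\<close>
  have i_less: "w i < w root"
  proof (rule ccontr)
    assume "\<not> w i < w root"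
    then have wi: "w i = w root" using w_le_root[of i] by simp
    have level: "adj root x \<and> w root \<le> w x" if "x \<noteq> root" "w x = w root" for x
      using parent[OF that(1)] that(2) w_le_root[of "parent x"] adj_sym by fastforce
    have "x = y" if "x \<noteq> root" "y \<noteq> root" "w x = w root" "w y = w root" for x y
      using upper_neighbour_unique[of root x y] level[of x] level[of y] that by simp
    from this[of i "\<pi> i"] this[of i "\<pi> (\<pi> i)"] this[of "\<pi> i" "\<pi> (\<pi> i)"]
    show False using i ne wi by (metis automorphism_eq_iff[OF \<pi>] w_automorphism[OF \<pi>])
  qed
  define p where "p = parent i"
  have ip: "adj i p" and wp: "w i < w p"
    using parent[of i] i_less by (force simp: p_def)+
  have \<pi>\<pi>p: "\<pi> (\<pi> p) = p" using max[of p] wp by force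
  have par: "parent i = p" "parent (\<pi> i) = \<pi> p" "parent (\<pi> (\<pi> i)) = p" "parent (\<pi> (\<pi> (\<pi> i))) = \<pi> p"
    using i_less by (simp_all add: p_def[symmetric] parent_automorphism[OF \<pi>] \<pi>\<pi>p)
  have nroot: "x \<noteq> root" if "w x = w i" for x using that i_less by auto
  have \<pi>p: "\<pi> p = p"
  proof (rule ccontr)
    assume np: "\<pi> p \<noteq> p"
    \<comment> \<open>Two nodes of \<open>C\<close> hang from \<open>p\<close> and two from
      \<open>\<pi> p\<close>. With the value 2 on \<open>T\<close> and 1 on \<open>C\<close>, both
      sides of the strict tree inequality become \<open>4 * card T + 4\<close>.\<close>
    define T where "T = {x. w i < w x}"
    define C where "C = {i, \<pi> i, \<pi> (\<pi> i), \<pi> (\<pi> (\<pi> i))}"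
    define v :: "'i \<Rightarrow> real" where "v x = (if x \<in> T then 2 else if x \<in> C then 1 else 0)" for x
    have "i \<noteq> \<pi> (\<pi> (\<pi> i))" using par np by metis
    then have card: "card C = 4" using i ne by (auto simp: C_def)
    have disj: "T \<inter> C = {}" by (auto simp: T_def C_def)
    have root: "root \<in> T" "root \<notin> C" using i_less by (auto simp: T_def C_def)
    have T: "parent x \<in> T" if "x \<in> T" "x \<noteq> root" for x
      using parent(2)[OF that(2)] that(1) by (auto simp: T_def)
    have C: "parent x \<in> T" if "x \<in> C" for x
      using that par wp by (auto simp: C_def T_def)
    have vT: "v x = 2" if "x \<in> T" for x using that by (simp add: v_def)
    have vC: "v x = 1" if "x \<in> C" for x using that disj by (auto simp: v_def)
    have "v i \<noteq> 0" by (auto simp: v_def C_def)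
    then have "(\<Sum>x\<in>(T - {root}) \<union> C. v x * v (parent x)) < (\<Sum>x\<in>T \<union> C. (v x)\<^sup>2)"
      using root by (intro tree_inequality_on) (auto simp: v_def)
    also have "(\<Sum>x\<in>(T - {root}) \<union> C. v x * v (parent x))
        = 4 * real (card (T - {root})) + 8"
      using disj by (subst sum.union_disjoint) (auto simp: vT vC T C card)
    also have "(\<Sum>x\<in>T \<union> C. (v x)\<^sup>2) = 4 * real (card T) + 4"
      using disj by (subst sum.union_disjoint) (auto simp: vT vC card)
    also have "card T = Suc (card (T - {root}))"
      using root(1) by (intro card.remove) auto
    finally show False by simp
  qed
  have npi: "p \<noteq> i" "p \<noteq> \<pi> i" "p \<noteq> \<pi> (\<pi> i)" using wp by auto
  have nb: "y \<in> {i, \<pi> i, \<pi> (\<pi> i)}" if y: "adj p y" for y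
  proof (rule ccontr)
    assume ny: "y \<notin> {i, \<pi> i, \<pi> (\<pi> i)}"
    have py: "p \<noteq> y" using y by (auto simp: adj_def)
    \<comment> \<open>A fourth neighbour \<open>y\<close> of \<open>p\<close> would give affine D4:
      2 at the centre and 1 at four ends make both sides equal to 8.\<close>
    define v :: "'i \<Rightarrow> real" where
      "v x = (if x = p then 2 else if x \<in> {i, \<pi> i, \<pi> (\<pi> i), y} then 1 else 0)" for x
    \<comment> \<open>Edges are listed by their lower end, and for the edge between \<open>p\<close>
      and \<open>y\<close> this may be either of the two.\<close>
    define z where "z = (if p \<noteq> root \<and> parent p = y then p else y)"
    have z: "z \<noteq> root \<and> v z * v (parent z) = 2"
    proof (cases "p \<noteq> root \<and> parent p = y")
      case False
      then have "\<not> (p \<noteq> root \<and> w p \<le> w y)" using parent_eqI[OF _ y] by auto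
      then have "w y \<le> w p" using w_le_root[of y] by auto
      moreover have "y \<noteq> root" using False py parent_eqI[OF _ y] w_le_root[of p] by auto
      ultimately show ?thesis
        using parent_eqI[OF _ adj_sym[OF y]] False py by (auto simp: z_def v_def)
    qed (use py in \<open>auto simp: z_def v_def\<close>)
    have zn: "z \<notin> {i, \<pi> i, \<pi> (\<pi> i)}" using ny npi by (auto simp: z_def)
    have "v p \<noteq> 0" by (auto simp: v_def)
    then have "(\<Sum>x\<in>{i, \<pi> i, \<pi> (\<pi> i), z}. v x * v (parent x)) < (\<Sum>x\<in>{p, i, \<pi> i, \<pi> (\<pi> i), y}. (v x)\<^sup>2)"
      using z nroot[of i] nroot[of "\<pi> i"] nroot[of "\<pi> (\<pi> i)"]
      by (intro tree_inequality_on) (auto simp: v_def)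
    also have "(\<Sum>x\<in>{p, i, \<pi> i, \<pi> (\<pi> i), y}. (v x)\<^sup>2) = 8"
      using i ne ny npi py by (auto simp: v_def)
    finally show False
      using z i ne zn npi par \<pi>p by (auto simp: v_def)
  qed
  \<comment> \<open>All neighbours of \<open>p\<close> are lighter than \<open>p\<close>, which
    leaves no candidate for its parent.\<close>
  have pr: "p = root"
  proof (rule ccontr)
    assume "p \<noteq> root"
    from nb[OF parent(1)[OF this]] parent(2)[OF this] wp show False by auto
  qed
  have \<pi>3: "\<pi> (\<pi> (\<pi> i)) = i"
  proof -
    have "adj (\<pi> (\<pi> (\<pi> i))) p"
      using parent(1)[of "\<pi> (\<pi> (\<pi> i))"] nroot par \<pi>p by simp
    from nb[OF adj_sym[OF this]] show ?thesis using i ne by auto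
  qed
  have all: "x \<in> {root, i, \<pi> i, \<pi> (\<pi> i)}" for x
  proof (rule ccontr)
    define B where "B = - {root, i, \<pi> i, \<pi> (\<pi> i)}"
    assume "x \<notin> {root, i, \<pi> i, \<pi> (\<pi> i)}"
    then obtain j where j: "j \<in> B" "\<And>z. z \<in> B \<Longrightarrow> w z \<le> w j"
      using ex_max_w[of x B] by (auto simp: B_def)
    \<comment> \<open>The neighbours of the root are the three legs, and \<open>j\<close> is
      heaviest among the remaining nodes, so its parent is a leg. Rotating by \<open>\<pi>\<close>
      hangs a further node on each leg.\<close>
    define q where "q = parent j"
    have "j \<noteq> root" using j by (auto simp: B_def)
    then have q: "q \<noteq> root" "w j < w q"
      using parent[of j] nb[of j] adj_sym[of j root] j(1) by (auto simp: q_def pr B_def)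
    then have "q \<in> {i, \<pi> i, \<pi> (\<pi> i)}" using j(2)[of q] by (auto simp: B_def)
    then have Q: "{q, \<pi> q, \<pi> (\<pi> q)} = {i, \<pi> i, \<pi> (\<pi> i)}" "q \<noteq> \<pi> q" "q \<noteq> \<pi> (\<pi> q)"
      using i ne \<pi>3 by auto
    have "w j < w root" using q(2) w_le_root[of q] by simp
    then have parj: "parent j = q" "parent (\<pi> j) = \<pi> q" "parent (\<pi> (\<pi> j)) = \<pi> (\<pi> q)"
      by (simp_all add: q_def parent_automorphism[OF \<pi>])
    define J where "J = {j, \<pi> j, \<pi> (\<pi> j)}"
    define I where "I = {i, \<pi> i, \<pi> (\<pi> i)}"
    \<comment> \<open>Affine E6: the values 3, 2, 1 from the centre outwards make both sides equal
      to 24.\<close>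
    define v :: "'i \<Rightarrow> real" where
      "v x = (if x = root then 3 else if x \<in> I then 2 else if x \<in> J then 1 else 0)" for x
    have "j \<noteq> \<pi> j" "j \<noteq> \<pi> (\<pi> j)" using parj Q(2,3) by metis+
    then have cJ: "card J = 3" by (simp add: J_def)
    have cI: "card I = 3" using i ne by (auto simp: I_def)
    have rI: "root \<notin> I" using npi by (auto simp: I_def pr)
    have pI: "parent x = root" if "x \<in> I" for x using that par \<pi>p by (auto simp: I_def pr)
    have pJ: "parent x \<in> I" if "x \<in> J" for x using that parj Q(1) by (auto simp: I_def J_def)
    have IJ: "I \<inter> J = {}" using pI pJ rI by fastforce
    have rJ: "root \<notin> J" using \<open>w j < w root\<close> by (auto simp: J_def)
    have vr: "v root = 3" by (simp add: v_def)
    have vI: "v x = 2" if "x \<in> I" for x using that rI by (auto simp: v_def)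
    have vJ: "v x = 1" if "x \<in> J" for x using that rJ IJ by (auto simp: v_def)
    have "v root \<noteq> 0" by (simp add: v_def)
    then have "(\<Sum>x\<in>I \<union> J. v x * v (parent x)) < (\<Sum>x\<in>insert root (I \<union> J). (v x)\<^sup>2)"
      using rI rJ by (intro tree_inequality_on) (auto simp: v_def)
    also have "(\<Sum>x\<in>I \<union> J. v x * v (parent x)) = (\<Sum>x\<in>I. 6) + (\<Sum>x\<in>J. 2)"
      using IJ by (subst sum.union_disjoint) (auto simp: vr vI vJ pI pJ)
    also have "(\<Sum>x\<in>insert root (I \<union> J). (v x)\<^sup>2) = 9 + (\<Sum>x\<in>I \<union> J. (v x)\<^sup>2)"
      using rI rJ by (simp add: vr)
    also have "(\<Sum>x\<in>I \<union> J. (v x)\<^sup>2) = (\<Sum>x\<in>I. 4) + (\<Sum>x\<in>J. 1)"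
      using IJ by (subst sum.union_disjoint) (auto simp: vI vJ)
    finally show False using cI cJ by simp
  qed
  have adj: "adj root x \<longleftrightarrow> x \<noteq> root" for x
  proof
    assume "x \<noteq> root"
    then have "x \<in> {i, \<pi> i, \<pi> (\<pi> i)}" using all[of x] by simp
    then have "parent x = root" using par \<pi>p pr by auto
    then show "adj root x" using parent(1)[OF \<open>x \<noteq> root\<close>] adj_sym by metis
  qed (auto simp: adj_def)
  have fix_root: "g root = root" if g: "diagram_automorphism a g" for g
  proof -
    have "w (g root) = w root" by (rule w_automorphism[OF g])
    then show ?thesis using all[of "g root"] i_less by auto
  qed
  from npi i ne have "distinct [root, i, \<pi> i, \<pi> (\<pi> i)]" by (auto simp: pr)
  then show thesis using that[of i] all \<pi>3 adj fix_root by blast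
qed

text \<open>On the three legs \<open>\<pi>\<close> is a 3-cycle and \<open>\<pi>'\<close> a
  transposition, and conjugation by a transposition inverts a 3-cycle.\<close>

lemma triality_involution:
  assumes \<pi>: "diagram_automorphism a \<pi>" "\<pi> \<circ> \<pi> \<noteq> id"
    and \<pi>': "diagram_automorphism a \<pi>'" "\<pi>' \<circ> \<pi>' = id" "\<pi>' \<noteq> id"
  shows "\<pi> (\<pi>' (\<pi> x)) = \<pi>' x" "\<pi>' x \<in> {x, \<pi> x, \<pi> (\<pi> x)}" "\<pi> (\<pi> (\<pi> x)) = x"
proof -
  from \<pi> obtain i where all: "\<And>x. x \<in> {root, i, \<pi> i, \<pi> (\<pi> i)}"
    and ne: "distinct [root, i, \<pi> i, \<pi> (\<pi> i)]" and 3: "\<pi> (\<pi> (\<pi> i)) = i"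
    and root: "\<And>g. diagram_automorphism a g \<Longrightarrow> g root = root"
    using triality[OF \<pi>] by metis
  have r: "\<pi> root = root" "\<pi>' root = root" using root \<pi>(1) \<pi>'(1) by auto
  have inv: "\<pi>' (\<pi>' x) = x" for x using \<pi>'(2) by (metis comp_apply id_apply)
  have vals: "\<pi>' x \<in> {i, \<pi> i, \<pi> (\<pi> i)}" if "x \<noteq> root" for x
    using all[of "\<pi>' x"] inv[of x] r that by auto
  have nid: "\<not> (\<pi>' i = i \<and> \<pi>' (\<pi> i) = \<pi> i \<and> \<pi>' (\<pi> (\<pi> i)) = \<pi> (\<pi> i))"
  proof
    assume "\<pi>' i = i \<and> \<pi>' (\<pi> i) = \<pi> i \<and> \<pi>' (\<pi> (\<pi> i)) = \<pi> (\<pi> i)"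
    then have "\<pi>' x = x" for x using all[of x] r by auto
    then show False using \<pi>'(3) by auto
  qed
  \<comment> \<open>A nontrivial involution of three points fixes exactly one of them.\<close>
  have cases: "g A = A \<and> g B = C \<and> g C = B \<or> g A = B \<and> g B = A \<and> g C = C \<or> g A = C \<and> g B = B \<and> g C = A"
    if "g A \<in> {A, B, C}" "g B \<in> {A, B, C}" "g C \<in> {A, B, C}" "\<And>x. g (g x) = x"
      "\<not> (g A = A \<and> g B = B \<and> g C = C)" "A \<noteq> B" "A \<noteq> C" "B \<noteq> C" for g and A B C :: 'i
    using that(1-3) that(4)[of A] that(4)[of B] that(4)[of C] that(5-8)
    by (elim insertE emptyE) simp_all
  consider "\<pi>' i = i" "\<pi>' (\<pi> i) = \<pi> (\<pi> i)" "\<pi>' (\<pi> (\<pi> i)) = \<pi> i"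
    | "\<pi>' i = \<pi> i" "\<pi>' (\<pi> i) = i" "\<pi>' (\<pi> (\<pi> i)) = \<pi> (\<pi> i)"
    | "\<pi>' i = \<pi> (\<pi> i)" "\<pi>' (\<pi> i) = \<pi> i" "\<pi>' (\<pi> (\<pi> i)) = i"
    using cases[of \<pi>' i "\<pi> i" "\<pi> (\<pi> i)", OF vals vals vals inv nid] ne by auto
  then show "\<pi> (\<pi>' (\<pi> x)) = \<pi>' x" "\<pi>' x \<in> {x, \<pi> x, \<pi> (\<pi> x)}" "\<pi> (\<pi> (\<pi> x)) = x"
    using all[of x] r 3 by (cases; auto)+
qed

end

section \<open>Invariant forms and the principal grading\<close>

lemma lie_automorphism_comp:
  "lie_automorphism sc br L \<phi> \<Longrightarrow> lie_automorphism sc br L \<psi> \<Longrightarrow> lie_automorphism sc br L (\<phi> \<circ> \<psi>)"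
  by (auto simp: lie_automorphism_def bij_betw_apply intro: bij_betw_trans)

definition invariant_bilinear ::
  "(complex \<Rightarrow> 'g::ab_group_add \<Rightarrow> 'g) \<Rightarrow> ('g \<Rightarrow> 'g \<Rightarrow> 'g) \<Rightarrow> ('g \<Rightarrow> 'g \<Rightarrow> complex) \<Rightarrow> bool" where
  "invariant_bilinear sc br B \<longleftrightarrow>
     (\<forall>x. Vector_Spaces.linear sc (*) (B x)) \<and>
     (\<forall>x. Vector_Spaces.linear sc (*) (\<lambda>y. B y x)) \<and>
     (\<forall>x y z. B (br x y) z = B x (br y z))"

text \<open>The index counts brackets, so elements at \<open>n\<close> have \<open>n + 1\<close>
  factors; hence the \<open>Suc n\<close> in the weights below.\<close>

primrec iterated_brackets :: "('g \<Rightarrow> 'g \<Rightarrow> 'g) \<Rightarrow> ('i \<Rightarrow> 'g) \<Rightarrow> nat \<Rightarrow> 'g set" where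
  "iterated_brackets br e 0 = range e"
| "iterated_brackets br e (Suc n) = {br (e i) x |i x. x \<in> iterated_brackets br e n}"

context lie_algebra
begin

lemma linear_functional_iff:
  "Vector_Spaces.linear scale (*) g \<longleftrightarrow>
     (\<forall>x y. g (x + y) = g x + g y) \<and> (\<forall>c x. g (scale c x) = c * g x)"
  by (simp add: Vector_Spaces.linear_iff vector_space_complex vector_space_axioms)

lemma br_zero [simp]: "br 0 x = 0" "br x 0 = 0"
  using br_scale_left[of 0 0 x] br_scale_right[of x 0 0] by simp_all

lemma br_minus_left: "br (- x) y = - br x y"
  using br_scale_left[of "-1" x y] by simp

lemma br_minus_right: "br x (- y) = - br x y"
  using br_scale_right[of x "-1" y] by simp

lemma br_skew: "br x y = - br y x"
  using br_self[of "x + y"] br_self[of x] br_self[of y]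
  by (simp add: br_add_left br_add_right eq_neg_iff_add_eq_0 add.commute)

lemma jacobi_left: "br (br x y) z = br x (br y z) - br y (br x z)"
proof -
  have "br x (br y z) + - br y (br x z) + br z (br x y) = 0"
    using jacobi[of x y z] by (simp add: br_skew[of z x] br_minus_right)
  then have "br x (br y z) - br y (br x z) = - br z (br x y)"
    by (simp add: eq_neg_iff_add_eq_0)
  also have "\<dots> = br (br x y) z" by (rule br_skew[symmetric])
  finally show ?thesis by simp
qed

lemma jacobi_right: "br x (br y z) = br (br x y) z + br y (br x z)"
  by (simp add: jacobi_left)

lemma br_sum_left: "br (sum g A) x = (\<Sum>i\<in>A. br (g i) x)"
  by (induction A rule: infinite_finite_induct) (auto simp: br_add_left)

lemma br_span_right:
  assumes "\<And>b. b \<in> B \<Longrightarrow> br y b \<in> S" "subspace S" "x \<in> span B"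
  shows "br y x \<in> S"
  using assms(3)
  by (induction rule: span_induct_alt)
    (use assms(1,2) in \<open>auto simp: subspace_0 br_add_right br_scale_right subspace_add subspace_scale\<close>)

lemma invariant_bilinear_simps:
  assumes "invariant_bilinear scale br B"
  shows "B (x + y) z = B x z + B y z" "B x (y + z) = B x y + B x z"
    "B (scale c x) y = c * B x y" "B x (scale c y) = c * B x y"
    "B 0 x = 0" "B x 0 = 0" "B (- x) y = - B x y" "B x (- y) = - B x y"
    "B (br x y) z = B x (br y z)"
proof -
  show add: "B (x + y) z = B x z + B y z" "B x (y + z) = B x y + B x z"
    and scale: "B (scale c x) y = c * B x y" "B x (scale c y) = c * B x y" for x y z c
    using assms by (simp_all add: invariant_bilinear_def linear_functional_iff)
  show "B 0 x = 0" "B x 0 = 0" "B (- x) y = - B x y" "B x (- y) = - B x y"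
    using scale(1)[of 0 0 x] scale(2)[of x 0 0] scale(1)[of "-1" x y] scale(2)[of x "-1" y] by simp_all
  show "B (br x y) z = B x (br y z)" using assms by (simp add: invariant_bilinear_def)
qed

text \<open>Moving \<open>k\<close> from one argument to the other gives
  \<open>c * B x y = - d * B x y\<close>.\<close>

lemma invariant_bilinear_weights:
  assumes B: "invariant_bilinear scale br B"
    and "br k x = scale c x" "br k y = scale d y" "c + d \<noteq> 0"
  shows "B x y = 0"
proof -
  note B = invariant_bilinear_simps[OF B]
  have "c * B x y = B (br k x) y" using assms by (simp add: B)
  also have "\<dots> = - B x (br k y)" by (simp add: br_skew[of k x] B)
  also have "\<dots> = - d * B x y" using assms by (simp add: B)
  finally show ?thesis using assms(4) by (simp add: eq_neg_iff_add_eq_0 flip: distrib_right)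
qed

end

locale chevalley_system = lie_algebra scale br
  for scale :: "complex \<Rightarrow> 'g::ab_group_add \<Rightarrow> 'g" and br :: "'g \<Rightarrow> 'g \<Rightarrow> 'g" +
  fixes form :: "'g \<Rightarrow> 'g \<Rightarrow> complex"
    and a :: "'i::finite \<Rightarrow> 'i \<Rightarrow> int" and h e f :: "'i \<Rightarrow> 'g"
  assumes simple: "lie_ideal scale br I \<Longrightarrow> I = {0} \<or> I = UNIV"
    and form: "nondegenerate_invariant_form scale br form"
    and cartan: "cartan_matrix a"
    and h_nonzero: "h i \<noteq> 0"
    and h_h: "br (h i) (h j) = 0"
    and h_e: "br (h i) (e j) = scale (of_int (a i j)) (e j)"
    and h_f: "br (h i) (f j) = scale (- of_int (a i j)) (f j)"
    and e_f: "br (e i) (f j) = (if i = j then h i else 0)"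
    and generated: "(lie_subalgebra scale br hull (range e \<union> range f)) = UNIV"
begin

text \<open>The Chevalley involution of the data lets every statement about the \<open>e i\<close> be read for the
  \<open>f i\<close>.\<close>

lemma opposite: "chevalley_system scale br form a (\<lambda>i. - h i) f e"
proof
  show "br (f i) (e j) = (if i = j then - h i else 0)" for i j
    using e_f[of j i] by (simp add: br_skew[of "f i"])
  show "(lie_subalgebra scale br hull (range f \<union> range e)) = UNIV"
    using generated by (simp add: Un_commute)
qed (use simple form cartan h_nonzero h_h h_e h_f in \<open>auto simp: br_minus_left br_minus_right\<close>)

lemma generated_induct:
  assumes "subspace K" "\<And>x y. x \<in> K \<Longrightarrow> y \<in> K \<Longrightarrow> br x y \<in> K" "\<And>i. e i \<in> K" "\<And>i. f i \<in> K"
  shows "x \<in> K"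
proof -
  have "(lie_subalgebra scale br hull (range e \<union> range f)) \<subseteq> K"
    using assms by (intro hull_minimal) (auto simp: lie_subalgebra_def)
  then show ?thesis using generated by auto
qed

lemma automorphism_eqI:
  assumes "lie_automorphism scale br UNIV \<phi>" "lie_automorphism scale br UNIV \<psi>"
    and "\<And>i. \<phi> (e i) = \<psi> (e i)" "\<And>i. \<phi> (f i) = \<psi> (f i)"
  shows "\<phi> = \<psi>"
proof -
  have "x \<in> {x. \<phi> x = \<psi> x}" for x
  proof (rule generated_induct)
    have "\<phi> 0 = 0" "\<psi> 0 = 0" using assms(1,2) by (auto simp: lie_automorphism_def dest!: spec[of _ 0])
    then show "subspace {x. \<phi> x = \<psi> x}"
      using assms(1,2) by (auto intro!: subspaceI simp: lie_automorphism_def)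
  qed (use assms in \<open>auto simp: lie_automorphism_def\<close>)
  then show ?thesis by auto
qed

lemma form_bilinear: "invariant_bilinear scale br form"
proof -
  have "(\<lambda>y. form y x) = form x" for x
    using form by (auto simp: nondegenerate_invariant_form_def)
  moreover have "Vector_Spaces.linear scale (*) (form x)" "form (br x y) z = form x (br y z)" for x y z
    using form by (auto simp: nondegenerate_invariant_form_def)
  ultimately show ?thesis by (auto simp only: invariant_bilinear_def)
qed

lemmas form_simps = invariant_bilinear_simps[OF form_bilinear]

lemma form_sym: "form x y = form y x"
  using form by (simp add: nondegenerate_invariant_form_def)

lemma form_nondegenerate: "(\<And>y. form x y = 0) \<Longrightarrow> x = 0"
  using form by (simp add: nondegenerate_invariant_form_def)

lemma e_nonzero: "e i \<noteq> 0"
  using e_f[of i i] h_nonzero[of i] by auto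

lemma e_eq_iff: "e i = e j \<longleftrightarrow> i = j"
  using e_f[of i i] e_f[of j i] h_nonzero[of i] by (auto split: if_splits)

section \<open>The principal grading\<close>

abbreviation "E \<equiv> iterated_brackets br e"
abbreviation "F \<equiv> iterated_brackets br f"

lemma h_E: "x \<in> E n \<Longrightarrow> \<exists>c. br (h k) x = scale c x"
proof (induction n arbitrary: x)
  case (Suc n)
  then obtain i y where x: "x = br (e i) y" "y \<in> E n" by auto
  with Suc.IH obtain c where "br (h k) y = scale c y" by blast
  with x(1) have "br (h k) x = scale (of_int (a k i) + c) x"
    by (simp add: jacobi_right[of "h k"] h_e br_scale_left br_scale_right scale_left_distrib)
  then show ?case by blast
qed (auto simp: h_e)

text \<open>Twice the sum of the fundamental coweights: every simple root takes the value 2 on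
  it.\<close>

definition "h0 = (\<Sum>i\<in>UNIV. scale (of_real (principal_weight a i)) (h i))"

lemma h0_e: "br h0 (e j) = scale 2 (e j)"
proof -
  have "(\<Sum>i\<in>UNIV. complex_of_real (principal_weight a i) * of_int (a i j))
      = of_real (\<Sum>i\<in>UNIV. principal_weight a i * of_int (a i j))" by simp
  also have "\<dots> = 2" by (simp only: principal_weight_eq[OF cartan]) simp
  finally have "(\<Sum>i\<in>UNIV. complex_of_real (principal_weight a i) * of_int (a i j)) = 2" .
  moreover have "br h0 (e j)
      = scale (\<Sum>i\<in>UNIV. complex_of_real (principal_weight a i) * of_int (a i j)) (e j)"
    by (simp add: h0_def br_sum_left br_scale_left h_e scale_sum_left)
  ultimately show ?thesis by simp
qed

lemma h0_E: "x \<in> E n \<Longrightarrow> br h0 x = scale (of_nat (2 * Suc n)) x"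
proof (induction n arbitrary: x)
  case (Suc n)
  then obtain i y where x: "x = br (e i) y" and "y \<in> E n" by auto
  then have "br h0 x = scale (2 + of_nat (2 * Suc n)) x"
    using Suc.IH[of y]
    by (simp only: x jacobi_right[of h0] h0_e br_scale_left br_scale_right scale_left_distrib)
  then show ?case by (simp add: algebra_simps)
qed (auto simp: h0_e)

lemma h0_opposite: "chevalley_system.h0 scale a (\<lambda>i. - h i) = - h0"
  by (simp add: chevalley_system.h0_def[OF opposite] h0_def sum_negf)

lemma h0_F: "x \<in> F n \<Longrightarrow> br h0 x = scale (- of_nat (2 * Suc n)) x"
  using chevalley_system.h0_E[OF opposite, of x n]
  by (metis br_minus_left h0_opposite minus_minus scale_minus_left)

lemma h0_h: "br h0 (h i) = 0"
  by (simp add: h0_def br_sum_left br_scale_left h_h)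

section \<open>Triangular decomposition\<close>

definition "triangular = range h \<union> (\<Union>n. E n) \<union> (\<Union>n. F n)"

text \<open>By the Jacobi identity \<open>e i\<close> either passes the outer factor
  \<open>f k\<close> or is absorbed with it into \<open>h k\<close>, which acts on the rest of the
  word by a scalar.\<close>

lemma br_e_F: "x \<in> F n \<Longrightarrow> br (e i) x \<in> span (range h \<union> (\<Union>n. F n))"
proof (induction n arbitrary: x)
  case 0
  then show ?case by (auto simp: e_f span_base span_zero)
next
  case (Suc n)
  let ?S = "span (range h \<union> (\<Union>n. F n))"
  from Suc.prems obtain k y where x: "x = br (f k) y" and y: "y \<in> F n" by auto
  have "br (br (e i) (f k)) y \<in> ?S"
  proof (cases "i = k")
    case True
    obtain c where "br (- h k) y = scale c y"
      using chevalley_system.h_E[OF opposite y] by auto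
    then have "br (h k) y = scale (- c) y"
      by (metis br_minus_left minus_minus scale_minus_left)
    moreover have "y \<in> ?S" using y by (intro span_base) auto
    ultimately show ?thesis using True by (simp add: e_f span_neg span_scale)
  qed (simp add: e_f span_zero)
  moreover have "br (f k) (br (e i) y) \<in> ?S"
  proof (rule br_span_right[OF _ subspace_span Suc.IH[OF y]])
    fix b assume "b \<in> range h \<union> (\<Union>n. F n)"
    then show "br (f k) b \<in> ?S"
    proof
      assume "b \<in> range h"
      then obtain j where "b = h j" by auto
      then have "br (f k) b = scale (of_int (a j k)) (f k)"
        by (simp add: br_skew[of "f k"] h_f)
      moreover have "f k \<in> F 0" by simp
      then have "f k \<in> ?S" by (intro span_base) blast
      ultimately show ?thesis by (simp add: span_scale)
    next
      assume "b \<in> (\<Union>n. F n)"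
      then obtain n where "b \<in> F n" by auto
      then have "br (f k) b \<in> F (Suc n)" by auto
      then show ?thesis by (intro span_base) blast
    qed
  qed
  ultimately show ?case by (simp add: x jacobi_right[of "e i"] span_add)
qed

lemma br_e_triangular: "x \<in> span triangular \<Longrightarrow> br (e i) x \<in> span triangular"
proof (rule br_span_right[OF _ subspace_span])
  fix b assume "b \<in> triangular"
  then consider j where "b = h j" | n where "b \<in> E n" | n where "b \<in> F n"
    by (auto simp: triangular_def)
  then show "br (e i) b \<in> span triangular"
  proof cases
    case 1
    then have "br (e i) b = scale (- of_int (a j i)) (e i)" by (simp add: br_skew[of "e i"] h_e)
    moreover have "e i \<in> E 0" by simp
    then have "e i \<in> span triangular" by (intro span_base) (unfold triangular_def, blast)
    ultimately show ?thesis by (simp add: span_neg span_scale)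
  next
    case 2
    then have "br (e i) b \<in> E (Suc n)" by auto
    then show ?thesis by (intro span_base) (unfold triangular_def, blast)
  next
    case 3
    then have "br (e i) b \<in> span (range h \<union> (\<Union>n. F n))" by (rule br_e_F)
    also have "\<dots> \<subseteq> span triangular" by (intro span_mono) (auto simp: triangular_def)
    finally show ?thesis .
  qed
qed

text \<open>The span is stable under all generators, hence a nonzero ideal. Stability under the
  \<open>f i\<close> comes from the opposite system, whose spanning set differs only in the signs of
  the \<open>h i\<close>.\<close>

lemma span_triangular: "span triangular = UNIV"
proof -
  have minus: "range (\<lambda>i. - h i) = uminus ` range h" by auto
  have "span (uminus ` A \<union> B) = span (A \<union> B)" for A B
  proof (rule span_eq[THEN iffD2], intro conjI subsetI)
    fix x assume "x \<in> uminus ` A \<union> B"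
    then show "x \<in> span (A \<union> B)" by (auto intro: span_base span_neg)
  next
    fix x assume "x \<in> A \<union> B"
    then show "x \<in> span (uminus ` A \<union> B)"
      using span_neg[OF span_base, of "- x" "uminus ` A \<union> B"] by (auto intro: span_base)
  qed
  then have opp: "span (chevalley_system.triangular br (\<lambda>i. - h i) f e) = span triangular"
    unfolding chevalley_system.triangular_def[OF opposite] triangular_def minus
    by (metis Un_assoc Un_commute)
  have "x \<in> {x. \<forall>y\<in>span triangular. br x y \<in> span triangular}" for x
  proof (rule generated_induct)
    show "subspace {x. \<forall>y\<in>span triangular. br x y \<in> span triangular}"
      by (rule subspaceI) (auto simp: br_add_left br_scale_left intro: span_add span_scale span_zero)
    fix x y assume "x \<in> {x. \<forall>y\<in>span triangular. br x y \<in> span triangular}"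
      "y \<in> {x. \<forall>y\<in>span triangular. br x y \<in> span triangular}"
    then show "br x y \<in> {x. \<forall>y\<in>span triangular. br x y \<in> span triangular}"
      by (auto simp: jacobi_left intro: span_diff)
  next
    fix i
    show "e i \<in> {x. \<forall>y\<in>span triangular. br x y \<in> span triangular}"
      by (auto intro: br_e_triangular)
    show "f i \<in> {x. \<forall>y\<in>span triangular. br x y \<in> span triangular}"
      using chevalley_system.br_e_triangular[OF opposite] by (auto simp: opp)
  qed
  then have "lie_ideal scale br (span triangular)" by (simp add: lie_ideal_def)
  then have "span triangular = {0} \<or> span triangular = UNIV" by (rule simple)
  moreover have "h i \<in> span triangular" for i by (rule span_base) (auto simp: triangular_def)
  ultimately show ?thesis using h_nonzero by auto
qed

lemma form_eq_0I:
  assumes "\<And>i. form x (h i) = 0" "\<And>n y. y \<in> E n \<Longrightarrow> form x y = 0" "\<And>n y. y \<in> F n \<Longrightarrow> form x y = 0"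
  shows "x = 0"
proof (rule form_nondegenerate)
  fix y have "y \<in> span triangular" by (simp add: span_triangular)
  then show "form x y = 0"
    by (induction rule: span_induct_alt) (use assms in \<open>auto simp: form_simps triangular_def\<close>)
qed

text \<open>The radical of an invariant form vanishing on the Cartan subalgebra contains that
  subalgebra, since the form pairs opposite degrees only; being an ideal, it is everything.\<close>

lemma invariant_bilinear_eq_0:
  assumes B: "invariant_bilinear scale br B" and h: "\<And>i j. B (h i) (h j) = 0"
  shows "B x y = 0"
proof -
  note Bs = invariant_bilinear_simps[OF B]
  define R where "R = {x. \<forall>y. B x y = 0}"
  have "br x y \<in> R" if "y \<in> R" for x y
    using that by (simp add: R_def br_skew[of x y] Bs)
  moreover have "subspace R" by (auto intro!: subspaceI simp: R_def Bs)
  ultimately have "lie_ideal scale br R" by (simp add: lie_ideal_def)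
  then have "R = {0} \<or> R = UNIV" by (rule simple)
  moreover have "h i \<in> R" for i
  proof -
    have "B (h i) y = 0" for y
    proof -
      have "y \<in> span triangular" by (simp add: span_triangular)
      then show ?thesis
      proof (induction rule: span_induct_alt)
        case (step c b y)
        have "B (h i) b = 0"
        proof -
          consider j where "b = h j" | n where "b \<in> E n" | n where "b \<in> F n"
            using step.hyps by (auto simp: triangular_def)
          then show ?thesis
          proof cases
            case 2
            show ?thesis
              by (rule invariant_bilinear_weights[OF B _ h0_E[OF 2], of _ 0])
                (simp_all add: h0_h del: of_nat_Suc of_nat_mult)
          next
            case 3
            show ?thesis
              by (rule invariant_bilinear_weights[OF B _ h0_F[OF 3], of _ 0])
                (simp_all add: h0_h del: of_nat_Suc of_nat_mult)
          qed (simp add: h)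
        qed
        with step show ?case by (simp add: Bs)
      qed (simp add: Bs)
    qed
    then show ?thesis by (simp add: R_def)
  qed
  ultimately have "R = UNIV" using h_nonzero by auto
  then show ?thesis by (auto simp: R_def)
qed

text \<open>The difference of the form and its pull-back along \<open>\<phi>\<close> is again
  invariant, so it vanishes once it does so on the coroots.\<close>

lemma form_automorphism:
  assumes \<phi>: "lie_automorphism scale br UNIV \<phi>"
    and h: "\<And>i j. form (\<phi> (h i)) (\<phi> (h j)) = form (h i) (h j)"
  shows "form (\<phi> x) (\<phi> y) = form x y"
proof -
  define B where "B x y = form (\<phi> x) (\<phi> y) - form x y" for x y
  have "invariant_bilinear scale br B"
    unfolding invariant_bilinear_def
  proof (intro conjI allI)
    show "B (br x y) z = B x (br y z)" for x y z
      using \<phi> by (simp add: B_def lie_automorphism_def form_simps)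
  qed (use \<phi> in \<open>auto simp: linear_functional_iff B_def lie_automorphism_def form_simps algebra_simps\<close>)
  then have "B x y = 0" by (rule invariant_bilinear_eq_0) (simp add: B_def h)
  then show ?thesis by (simp add: B_def)
qed

section \<open>The form on simple root vectors, and connectedness of the diagram\<close>

lemma form_h_h: "form (h i) (h j) = of_int (a j i) * form (e i) (f i)"
proof -
  have "form (h i) (h j) = form (br (e i) (f i)) (h j)" by (simp add: e_f)
  also have "\<dots> = form (e i) (br (f i) (h j))" by (simp add: form_simps)
  also have "br (f i) (h j) = scale (of_int (a j i)) (f i)" by (simp add: br_skew[of "f i"] h_f)
  finally show ?thesis by (simp add: form_simps)
qed

text \<open>By symmetry of the form on coroots, the values \<open>form (e i) (f i)\<close> at the
  two ends of an edge determine each other.\<close>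

lemma form_e_f_symmetrizes: "of_int (a j i) * form (e i) (f i) = of_int (a i j) * form (e j) (f j)"
  using form_h_h[of i j] form_h_h[of j i] form_sym[of "h i" "h j"] by simp

text \<open>As \<open>a i i = 2\<close> and \<open>a i j \<le> 0\<close>, the coroot
  \<open>h i\<close> separates the simple root at \<open>i\<close> from the others.\<close>

lemma weight_difference: "i \<noteq> j \<Longrightarrow> complex_of_int (a i i) + - of_int (a i j) \<noteq> 0"
  using cartan_matrix_nonpos[OF cartan, of i j] cartan_matrix_diag[OF cartan, of i]
  unfolding add_uminus_conv_diff right_minus_eq of_int_eq_iff by linarith

lemma form_e_f: "i \<noteq> j \<Longrightarrow> form (e i) (f j) = 0"
  by (rule invariant_bilinear_weights[OF form_bilinear h_e[of i] h_f[of i]])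
    (rule weight_difference)

text \<open>By nondegeneracy it suffices to pair with brackets \<open>br (f k) (f l)\<close>. After
  moving \<open>e j\<close> across the form, only \<open>f i\<close> could pair with
  \<open>e i\<close>, and its coefficient is \<open>a j i = 0\<close> up to sign.\<close>

lemma e_e:
  assumes "a i j = 0"
  shows "br (e i) (e j) = 0"
proof (rule form_eq_0I)
  have x: "br (e i) (e j) \<in> E 1" by auto
  note weights = invariant_bilinear_weights[OF form_bilinear h0_E[OF x]]
  show "form (br (e i) (e j)) (h k) = 0" for k
    by (rule weights[where d = 0]) (simp_all add: h0_h)
  show "form (br (e i) (e j)) y = 0" if "y \<in> E n" for n y
    by (rule weights[OF h0_E[OF that]]) (simp only: of_nat_eq_0_iff flip: of_nat_add; simp)
  show "form (br (e i) (e j)) y = 0" if y: "y \<in> F n" for n y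
  \<comment> \<open>\<open>F 1\<close> consists of two-factor brackets, the only ones of degree
    opposite to \<open>br (e i) (e j)\<close>.\<close>
  proof (cases "n = 1")
    case True
    then obtain k l where y: "y = br (f k) (f l)" using y by auto
    have ji: "a j i = 0" using assms cartan_matrix_zero_sym[OF cartan] by auto
    have "br (e j) y = (if j = k then scale (- of_int (a j l)) (f l) else 0)
        + (if j = l then scale (of_int (a j k)) (f k) else 0)"
      by (simp add: y jacobi_right[of "e j"] e_f h_f br_skew[of "f k" "h _"])
    then have "form (e i) (br (e j) y) = 0"
      using form_e_f[of i k] form_e_f[of i l] ji by (auto simp: form_simps)
    then show ?thesis by (simp add: form_simps)
  next
    case False
    then show ?thesis
      by (intro weights[OF h0_F[OF y]]) (simp only: add_uminus_conv_diff right_minus_eq of_nat_eq_iff; simp)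
  qed
qed

text \<open>Generators at nodes outside \<open>S\<close> commute with those inside, so the
  subalgebra \<open>Q\<close> generated from \<open>S\<close> is a nonzero ideal. Then
  \<open>Q\<close> would contain \<open>h j\<close> for some \<open>j \<notin> S\<close>, although
  \<open>e j\<close> centralizes \<open>Q\<close> and has weight 2 under \<open>h j\<close>.\<close>

lemma connected:
  assumes S: "S \<noteq> {}" "\<And>i j. i \<in> S \<Longrightarrow> a i j \<noteq> 0 \<Longrightarrow> j \<in> S"
  shows "S = UNIV"
proof (rule ccontr)
  assume "S \<noteq> UNIV"
  then obtain j where j: "j \<notin> S" by auto
  have comm: "br (e i) (e j) = 0" "br (f i) (e j) = 0" if "i \<in> S" "j \<notin> S" for i j
    using that S(2)[of i j] e_e[of i j] e_f[of j i] br_skew[of "f i" "e j"] by auto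
  have comm': "br (f i) (f j) = 0" "br (e i) (f j) = 0" if "i \<in> S" "j \<notin> S" for i j
    using that S(2)[of i j] chevalley_system.e_e[OF opposite, of i j] e_f[of i j] by auto
  define Q where "Q = lie_subalgebra scale br hull (e ` S \<union> f ` S)"
  have Q: "lie_subalgebra scale br Q"
    unfolding Q_def by (rule hull_in) (auto simp: lie_subalgebra_def intro: subspace_Inter)
  have base: "e ` S \<union> f ` S \<subseteq> Q" unfolding Q_def by (rule hull_subset)
  have cent: "br x y = 0" if "x \<in> Q" "\<And>i. i \<in> S \<Longrightarrow> br (e i) y = 0" "\<And>i. i \<in> S \<Longrightarrow> br (f i) y = 0"
    for x y
  proof -
    have "Q \<subseteq> {x. br x y = 0}"
      unfolding Q_def using that
      by (intro hull_minimal)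
        (auto simp: lie_subalgebra_def br_add_left br_scale_left jacobi_left intro!: subspaceI)
    with that(1) show ?thesis by auto
  qed
  have zero: "0 \<in> Q" using Q by (auto simp: lie_subalgebra_def subspace_0)
  have "x \<in> {x. \<forall>y\<in>Q. br x y \<in> Q}" for x
  proof (rule generated_induct)
    show "subspace {x. \<forall>y\<in>Q. br x y \<in> Q}"
      using Q by (auto intro!: subspaceI simp: lie_subalgebra_def br_add_left br_scale_left
          subspace_add subspace_scale zero)
    show "br x y \<in> {x. \<forall>y\<in>Q. br x y \<in> Q}"
      if "x \<in> {x. \<forall>y\<in>Q. br x y \<in> Q}" "y \<in> {x. \<forall>y\<in>Q. br x y \<in> Q}" for x y
      using that Q by (auto simp: jacobi_left lie_subalgebra_def subspace_diff)
    show "e i \<in> {x. \<forall>y\<in>Q. br x y \<in> Q}" for i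
    proof (cases "i \<in> S")
      case True
      then show ?thesis using Q base by (auto simp: lie_subalgebra_def)
    next
      case False
      then have "br y (e i) = 0" if "y \<in> Q" for y using cent[OF that, of "e i"] comm by auto
      then show ?thesis using br_skew[of "e i"] zero by auto
    qed
    show "f i \<in> {x. \<forall>y\<in>Q. br x y \<in> Q}" for i
    proof (cases "i \<in> S")
      case True
      then show ?thesis using Q base by (auto simp: lie_subalgebra_def)
    next
      case False
      then have "br y (f i) = 0" if "y \<in> Q" for y using cent[OF that, of "f i"] comm' by auto
      then show ?thesis using br_skew[of "f i"] zero by auto
    qed
  qed
  then have "lie_ideal scale br Q" using Q by (simp add: lie_ideal_def lie_subalgebra_def)
  then have "Q = {0} \<or> Q = UNIV" by (rule simple)
  moreover from S(1) base e_nonzero have "Q \<noteq> {0}" by auto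
  ultimately have "h j \<in> Q" by auto
  from cent[OF this, of "e j"] comm j have "br (h j) (e j) = 0" by auto
  then show False using e_nonzero[of j] by (simp add: h_e cartan_matrix_diag[OF cartan])
qed

sublocale connected_dynkin a
  by unfold_locales (fact cartan, fact connected)

text \<open>Subtracting the multiple of \<open>f j\<close> that makes \<open>x\<close> orthogonal to \<open>e j\<close> leaves a vector in the
  radical of the form.\<close>

lemma simple_root_space:
  assumes x: "\<And>i. br (h i) x = scale (- of_int (a i j)) x"
  shows "\<exists>c. x = scale c (f j)"
proof -
  have h0x: "br h0 y = scale (- of_nat 2) y" if "\<And>i. br (h i) y = scale (- of_int (a i j)) y" for y
  proof -
    have "br h0 y = scale (- (\<Sum>i\<in>UNIV. of_real (principal_weight a i) * of_int (a i j))) y"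
      by (simp add: h0_def br_sum_left br_scale_left that scale_sum_left sum_negf)
    also have "(\<Sum>i\<in>UNIV. complex_of_real (principal_weight a i) * of_int (a i j))
      = of_real (\<Sum>i\<in>UNIV. principal_weight a i * of_int (a i j))" by simp
    also have "\<dots> = 2" by (simp only: principal_weight_eq[OF cartan]) simp
    finally show ?thesis by simp
  qed
  have zero: "y = 0" if y: "\<And>i. br (h i) y = scale (- of_int (a i j)) y" and yj: "form y (e j) = 0" for y
  proof (rule form_eq_0I)
    note weights = invariant_bilinear_weights[OF form_bilinear h0x[OF y]]
    show "form y (h i) = 0" for i by (rule weights[where d = 0]) (simp_all add: h0_h)
    show "form y z = 0" if "z \<in> F n" for n z
      by (rule weights[OF h0_F[OF that]]) (simp only: neg_equal_0_iff_equal of_nat_eq_0_iff flip: minus_add_distrib of_nat_add; simp)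
    \<comment> \<open>Only \<open>E 0\<close> has the opposite degree, and there \<open>h k\<close>
      rules out \<open>e k\<close> for \<open>k \<noteq> j\<close>.\<close>
    show "form y z = 0" if z: "z \<in> E n" for n z
    proof (cases n)
      case 0
      then obtain k where k: "z = e k" using z by auto
      show ?thesis
      proof (cases "k = j")
        case False
        show ?thesis unfolding k
          by (rule invariant_bilinear_weights[OF form_bilinear y[of k] h_e[of k k]])
            (use weight_difference[OF False] in \<open>simp add: add.commute\<close>)
      qed (simp add: k yj)
    next
      case (Suc m)
      then show ?thesis
        by (intro weights[OF h0_E[OF z]])
          (simp only: add.commute[of "- _"] add_uminus_conv_diff right_minus_eq of_nat_eq_iff; simp)
    qed
  qed
  define c where "c = form x (e j) / form (f j) (e j)"
  \<comment> \<open>Otherwise \<open>zero\<close> would apply to \<open>f j\<close> itself.\<close>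
  have "form (f j) (e j) \<noteq> 0"
    using zero[of "f j"] h_f chevalley_system.e_nonzero[OF opposite] by auto
  then have "form (x + scale (- c) (f j)) (e j) = 0"
    by (simp add: form_simps c_def del: scale_minus_left)
  moreover have "br (h i) (x + scale (- c) (f j)) = scale (- of_int (a i j)) (x + scale (- c) (f j))" for i
    by (simp only: br_add_right br_scale_right x h_f scale_right_distrib scale_left_commute)
  ultimately have "x + scale (- c) (f j) = 0" by (intro zero)
  then show ?thesis by (auto simp: add_eq_0_iff2)
qed

end

section \<open>The bar map on extended twisted loop algebras\<close>

lemma loop_bracket_eq:
  assumes "lie_algebra sc br"
  shows "loop_bracket sc br \<mu> u v = (\<Sum>x\<in>Poly_Mapping.keys u. \<Sum>y\<in>Poly_Mapping.keys v.
    Poly_Mapping.single (x + y) (sc (\<mu> x y) (br (Poly_Mapping.lookup u x) (Poly_Mapping.lookup v y))))"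
proof -
  interpret lie_algebra sc br by fact
  have "tensor sc z (torus_mult \<mu> (torus_basis x) (torus_basis y)) = Poly_Mapping.single (x + y) (sc (\<mu> x y) z)"
    for x y z
    by (rule poly_mapping_eqI)
      (auto simp: tensor_def torus_mult_def torus_basis_def Poly_Mapping.map.rep_eq lookup_single when_def)
  then show ?thesis by (simp add: loop_bracket_def)
qed

lemma loop_form_eq:
  "loop_form form \<mu> u v = (\<Sum>x\<in>Poly_Mapping.keys u. \<Sum>y\<in>Poly_Mapping.keys v.
     form (Poly_Mapping.lookup u x) (Poly_Mapping.lookup v y) * (if x = - y then \<mu> x y else 0))"
  by (simp add: loop_form_def torus_form_def torus_basis_def keys_single lookup_single cong: sum.cong)

section \<open>Sign reversal on degrees and on the dual space\<close>

interpretation cx: vector_space cx_scale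
  by (rule vector_space_cx_scale)

lemma cx_embed_minus: "cx_embed (- l) = - cx_embed l"
proof -
  have "cx_embed 0 = (0 :: 'a complexification)" using cx_embed_add[of "0::'a" 0] by simp
  then show ?thesis using cx_embed_add[of "- l" l] by (simp add: eq_neg_iff_add_eq_0)
qed

lemma dual_space_minus: "d \<in> dual_space \<Longrightarrow> d (- x) = - d x"
  unfolding dual_space_def by (auto dest: module_hom.neg[OF Vector_Spaces.linear.axioms(3)])

lemma uminus_dual_space: "d \<in> dual_space \<Longrightarrow> - d \<in> dual_space"
  by (auto simp: dual_space_def Vector_Spaces.linear_iff)

text \<open>\<open>loop_bar \<theta>\<close> is the component of the bar map on the loop algebra, for \<open>\<theta> = \<psi>\<tau>\<close>.\<close>

definition loop_bar :: "('g::ab_group_add \<Rightarrow> 'g) \<Rightarrow> ('l::ab_group_add \<Rightarrow>\<^sub>0 'g) \<Rightarrow> ('l \<Rightarrow>\<^sub>0 'g)" where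
  "loop_bar \<theta> u = (\<Sum>l\<in>Poly_Mapping.keys u. Poly_Mapping.single (- l) (\<theta> (Poly_Mapping.lookup u l)))"

lemma bar_map_eq: "bar_map \<psi> \<tau> (u, v, d) = (loop_bar (\<psi> \<circ> \<tau>) u, - v, - d)"
  by (simp add: bar_map_def loop_bar_def)

locale opposite_automorphism = lie_algebra scale br
  for scale :: "complex \<Rightarrow> 'g::ab_group_add \<Rightarrow> 'g" and br :: "'g \<Rightarrow> 'g \<Rightarrow> 'g" +
  fixes form :: "'g \<Rightarrow> 'g \<Rightarrow> complex" and \<mu> :: "'l::ab_group_add \<Rightarrow> 'l \<Rightarrow> complex" and \<theta> :: "'g \<Rightarrow> 'g"
  assumes automorphism: "lie_automorphism scale br UNIV \<theta>"
    and isometry: "form (\<theta> x) (\<theta> y) = form x y"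
    and cocycle_opposite: "\<mu> (- k) (- l) = \<mu> k l"
begin

lemma \<theta>_simps:
  "\<theta> (x + y) = \<theta> x + \<theta> y" "\<theta> (scale c x) = scale c (\<theta> x)" "\<theta> (br x y) = br (\<theta> x) (\<theta> y)"
  "\<theta> 0 = 0" "\<theta> (- x) = - \<theta> x" "\<theta> x = 0 \<longleftrightarrow> x = 0"
proof -
  show add: "\<theta> (x + y) = \<theta> x + \<theta> y" and "\<theta> (br x y) = br (\<theta> x) (\<theta> y)"
    and scale: "\<theta> (scale c x) = scale c (\<theta> x)" for x y c
    using automorphism by (auto simp: lie_automorphism_def)
  show zero: "\<theta> 0 = 0" using scale[of 0 0] by simp
  show "\<theta> (- x) = - \<theta> x" using scale[of "-1" x] by simp
  have "inj \<theta>" using automorphism by (auto simp: lie_automorphism_def bij_betw_def)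
  then show "\<theta> x = 0 \<longleftrightarrow> x = 0" using zero by (metis injD)
qed

lemma lookup_loop_bar [simp]: "Poly_Mapping.lookup (loop_bar \<theta> u) l = \<theta> (Poly_Mapping.lookup u (- l))"
proof -
  have "Poly_Mapping.lookup (loop_bar \<theta> u) l
      = (\<Sum>k\<in>Poly_Mapping.keys u. if k = - l then \<theta> (Poly_Mapping.lookup u k) else 0)"
    unfolding loop_bar_def lookup_sum
    by (intro sum.cong refl) (auto simp: lookup_single when_def minus_equation_iff)
  then show ?thesis by (simp add: \<theta>_simps in_keys_iff)
qed

lemma keys_loop_bar: "Poly_Mapping.keys (loop_bar \<theta> u) = uminus ` Poly_Mapping.keys u"
proof -
  have "l \<in> uminus ` Poly_Mapping.keys u \<longleftrightarrow> - l \<in> Poly_Mapping.keys u" for l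
    by (metis image_iff minus_minus)
  then show ?thesis by (auto simp: in_keys_iff \<theta>_simps)
qed

lemma sum_keys_loop_bar: "(\<Sum>l\<in>Poly_Mapping.keys (loop_bar \<theta> u). g l) = (\<Sum>l\<in>Poly_Mapping.keys u. g (- l))"
  by (simp add: keys_loop_bar sum.reindex inj_on_def)

text \<open>Applications are taken in pairs because two of them restore the degree.\<close>

lemma lookup_loop_bar_funpow:
  "Poly_Mapping.lookup (((loop_bar \<theta> \<circ> loop_bar \<theta>) ^^ k) u) l = (\<theta> ^^ k) ((\<theta> ^^ k) (Poly_Mapping.lookup u l))"
  by (induction k arbitrary: u) (simp_all add: funpow_Suc_right funpow_swap1 del: funpow.simps(2))

lemma loop_bar_add: "loop_bar \<theta> (u + v) = loop_bar \<theta> u + loop_bar \<theta> v"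
  by (rule poly_mapping_eqI) (simp add: lookup_add \<theta>_simps)

lemma loop_bar_minus: "loop_bar \<theta> (u - v) = loop_bar \<theta> u - loop_bar \<theta> v"
  using loop_bar_add[of "u - v" v] by (simp add: eq_diff_eq)

lemma loop_bar_zero: "loop_bar \<theta> 0 = 0"
  by (simp add: loop_bar_def)

lemma loop_bar_sum: "loop_bar \<theta> (\<Sum>i\<in>I. g i) = (\<Sum>i\<in>I. loop_bar \<theta> (g i))"
  by (induction I rule: infinite_finite_induct) (auto simp: loop_bar_add loop_bar_zero)

lemma loop_bar_single: "loop_bar \<theta> (Poly_Mapping.single l x) = Poly_Mapping.single (- l) (\<theta> x)"
  by (rule poly_mapping_eqI) (auto simp: lookup_single when_def \<theta>_simps)

lemma loop_bar_scale: "loop_bar \<theta> (pm_scale scale c u) = pm_scale scale c (loop_bar \<theta> u)"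
  by (rule poly_mapping_eqI) (simp add: pm_scale_def Poly_Mapping.map.rep_eq when_def \<theta>_simps)

lemma loop_bar_bracket:
  "loop_bar \<theta> (loop_bracket scale br \<mu> u v) = loop_bracket scale br \<mu> (loop_bar \<theta> u) (loop_bar \<theta> v)"
  by (simp add: loop_bracket_eq[OF lie_algebra_axioms] loop_bar_sum loop_bar_single sum_keys_loop_bar
      \<theta>_simps cocycle_opposite add.commute)

lemma loop_form_bar: "loop_form form \<mu> (loop_bar \<theta> u) (loop_bar \<theta> v) = loop_form form \<mu> u v"
proof -
  have "(if - x = y then \<mu> (- x) (- y) else 0) = (if x = - y then \<mu> x y else 0)" for x y
    by (metis cocycle_opposite minus_minus)
  then show ?thesis
    by (simp add: loop_form_eq sum_keys_loop_bar isometry)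
qed

text \<open>At degree \<open>- l\<close> the functional \<open>- d\<close> takes the value of
  \<open>d\<close> at \<open>l\<close>.\<close>

lemma loop_bar_degree:
  assumes "d \<in> dual_space"
  shows "loop_bar \<theta> (degree_derivation scale d u) = degree_derivation scale (- d) (loop_bar \<theta> u)"
  by (simp add: degree_derivation_def loop_bar_sum loop_bar_single sum_keys_loop_bar \<theta>_simps
      cx_embed_minus dual_space_minus[OF assms])

text \<open>The form is preserved while the degree that it multiplies changes sign.\<close>

lemma central_part_bar:
  "central_part form \<mu> (loop_bar \<theta> u) (loop_bar \<theta> v) = - central_part form \<mu> u v"
proof -
  have "loop_form form \<mu> (Poly_Mapping.single (- l) (\<theta> x)) (loop_bar \<theta> v)
      = loop_form form \<mu> (Poly_Mapping.single l x) v" for l x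
    by (simp only: loop_bar_single[symmetric] loop_form_bar)
  then show ?thesis
    by (simp add: central_part_def sum_keys_loop_bar cx_embed_minus sum_negf)
qed

end

text \<open>Exponents of a root of unity of order \<open>m\<close> matter modulo \<open>m\<close>
  only. This shape serves both the degrees \<open>\<rho> (- l)\<close>, \<open>\<rho> l\<close> and
  the case \<open>m = 2\<close> with \<open>j = k\<close>.\<close>

lemma omega_powi_neg_cong:
  assumes "m > 0" "(j + k) mod int m = 0"
  shows "exp (2 * complex_of_real pi * \<i> / of_nat m) powi (- j)
    = exp (2 * complex_of_real pi * \<i> / of_nat m) powi k"
proof -
  let ?\<omega> = "exp (2 * complex_of_real pi * \<i> / of_nat m)"
  have "?\<omega> ^ m = exp (of_nat m * (2 * complex_of_real pi * \<i> / of_nat m))"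
    by (rule exp_of_nat_mult[symmetric])
  also have "\<dots> = 1" using assms(1) by simp
  finally have "?\<omega> powi (int m) = 1" by simp
  moreover obtain q where "j + k = int m * q" using assms(2) by auto
  ultimately have "?\<omega> powi (j + k) = 1" by (simp add: power_int_mult)
  moreover have "?\<omega> powi k = ?\<omega> powi (- j) * ?\<omega> powi (j + k)"
    by (subst power_int_add[symmetric]) auto
  ultimately show ?thesis by simp
qed

text \<open>\<open>\<rho> (- l)\<close> is the residue representing \<open>- \<rho> l\<close>, so
  the two agree as a congruence rather than as integers.\<close>

lemma epi_integer_mod_group_minus:
  assumes "\<rho> \<in> epi additive_group (integer_mod_group m)"
  shows "(\<rho> l + \<rho> (- l)) mod int m = 0"
proof -
  have add: "\<rho> (x + y) = (\<rho> x + \<rho> y) mod int m" for x y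
    using assms by (auto simp: epi_def hom_def additive_group_def)
  have "\<rho> 0 = (\<rho> 0 + \<rho> 0) mod int m" using add[of 0 0] by simp
  then have "\<rho> 0 mod int m = \<rho> 0" by (metis mod_mod_trivial)
  then have "(\<rho> 0 + \<rho> 0) mod int m = (\<rho> 0 + 0) mod int m" using add[of 0 0] by simp
  then have "\<rho> 0 mod int m = 0" 
    by (simp only: mod_eq_dvd_iff) simp
  then show ?thesis using add[of l "- l"] \<open>\<rho> 0 mod int m = \<rho> 0\<close> by simp
qed

theorem bar_map_chevalley:
  fixes scale :: "complex \<Rightarrow> 'g::ab_group_add \<Rightarrow> 'g" and \<rho> :: "'l::ab_group_add \<Rightarrow> int"
  assumes L: "lie_algebra scale br" and m: "m > 0"
    and aut: "lie_automorphism scale br UNIV (\<psi> \<circ> \<tau>)"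
    and isometry: "\<And>x y. form ((\<psi> \<circ> \<tau>) x) ((\<psi> \<circ> \<tau>) y) = form x y"
    and N: "N > 0" "(\<psi> \<circ> \<tau>) ^^ N = id"
    and eig: "\<And>j x. x \<in> eigenspace scale \<sigma> m j \<Longrightarrow> (\<psi> \<circ> \<tau>) x \<in> eigenspace scale \<sigma> m (- j)"
    and fixed: "\<And>x. x \<in> H \<Longrightarrow> \<sigma> x = x \<Longrightarrow> (\<psi> \<circ> \<tau>) x = - x"
    and \<mu>: "\<And>k l. \<mu> (- k) (- l) = \<mu> k l"
    and \<rho>: "\<rho> \<in> epi additive_group (integer_mod_group m)"
  shows "chevalley_automorphism (extended_scale scale) (extended_bracket scale br form \<mu>)
    (extended_twisted_loop scale \<sigma> m \<rho>) (extended_cartan scale H \<sigma>) (bar_map \<psi> \<tau>)"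
proof -
  define \<theta> where "\<theta> = \<psi> \<circ> \<tau>"
  let ?b = "bar_map \<psi> \<tau> :: ('l, 'g) extended_loop \<Rightarrow> _" and ?L = "extended_twisted_loop scale \<sigma> m \<rho>"
  interpret opposite_automorphism scale br form \<mu> \<theta>
    using L aut isometry \<mu> by (simp add: \<theta>_def opposite_automorphism_def opposite_automorphism_axioms_def)
  have maps: "?b p \<in> ?L" if "p \<in> ?L" for p
  proof -
    obtain u v d where p: "p = (u, v, d)" by (cases p)
    have u: "Poly_Mapping.lookup u l \<in> eigenspace scale \<sigma> m (\<rho> l)" and d: "d \<in> dual_space" for l
      using that by (auto simp: p extended_twisted_loop_def twisted_loop_def)
    have "\<theta> (Poly_Mapping.lookup u (- l)) \<in> eigenspace scale \<sigma> m (\<rho> l)" for l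
    proof -
      have "\<theta> (Poly_Mapping.lookup u (- l)) \<in> eigenspace scale \<sigma> m (- \<rho> (- l))" using eig[OF u] by (simp add: \<theta>_def)
      then show ?thesis
        using omega_powi_neg_cong[OF m, of "\<rho> (- l)" "\<rho> l"] epi_integer_mod_group_minus[OF \<rho>, of l]
        by (simp add: eigenspace_def add.commute)
    qed
    then show ?thesis
      using uminus_dual_space[OF d] by (simp add: p bar_map_eq \<theta>_def[symmetric] extended_twisted_loop_def twisted_loop_def)
  qed
  have iter: "((?b \<circ> ?b) ^^ k) (u, v, d) = (((loop_bar \<theta> \<circ> loop_bar \<theta>) ^^ k) u, v, d)" for k u v d
    by (induction k) (simp_all add: bar_map_eq \<theta>_def[symmetric])
  \<comment> \<open>An even power cancels the signs on the central part and the dual space and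
    restores degrees; \<open>N\<close> pairs apply \<open>\<theta>\<close> to each coefficient
    \<open>2 * N\<close> times.\<close>
  have b_iter: "(?b ^^ (2 * N)) p = p" for p
  proof -
    obtain u v d where p: "p = (u, v, d)" by (cases p)
    have "((loop_bar \<theta> \<circ> loop_bar \<theta>) ^^ N) u = u"
      by (rule poly_mapping_eqI) (simp add: lookup_loop_bar_funpow N(2)[folded \<theta>_def])
    moreover have "?b \<circ> ?b = ?b ^^ 2" by (simp add: numeral_2_eq_2)
    then have "?b ^^ (2 * N) = (?b \<circ> ?b) ^^ N" by (metis funpow_mult)
    ultimately show ?thesis by (simp add: p iter)
  qed
  \<comment> \<open>The power \<open>M\<close>, one short of the period \<open>2 * N\<close>, is the
    inverse of the bar map.\<close>
  obtain M where M: "2 * N = Suc M" using N(1) by (cases "2 * N") auto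
  have maps_iter: "(?b ^^ k) p \<in> ?L" if "p \<in> ?L" for k p
    using that by (induction k) (auto intro: maps)
  have "bij_betw ?b ?L ?L"
    by (rule bij_betw_byWitness[where f' = "?b ^^ M"])
      (use b_iter in \<open>auto simp: M funpow_swap1 intro: maps maps_iter\<close>)
  moreover have "?b (p + q) = ?b p + ?b q" for p q
    by (cases p; cases q) (simp add: bar_map_eq \<theta>_def[symmetric] loop_bar_add)
  moreover have "?b (extended_scale scale c p) = extended_scale scale c (?b p)" for c p
    by (cases p) (simp add: extended_scale_def bar_map_eq \<theta>_def[symmetric] loop_bar_scale fun_eq_iff)
  moreover have "?b (extended_bracket scale br form \<mu> p q) = extended_bracket scale br form \<mu> (?b p) (?b q)"
    if "p \<in> ?L" "q \<in> ?L" for p q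
  proof -
    obtain u v d u' v' d' where pq: "p = (u, v, d)" "q = (u', v', d')" by (cases p; cases q)
    then have "d \<in> dual_space" "d' \<in> dual_space" using that by (auto simp: extended_twisted_loop_def)
    then show ?thesis
      by (simp add: pq extended_bracket_def bar_map_eq \<theta>_def[symmetric] loop_bar_add loop_bar_minus loop_bar_bracket
          loop_bar_degree central_part_bar)
  qed
  ultimately have "lie_automorphism (extended_scale scale) (extended_bracket scale br form \<mu>) ?L ?b"
    by (simp add: lie_automorphism_def)
  moreover have "?b p = - p" if p_in: "p \<in> extended_cartan scale H \<sigma>" for p
  proof -
    obtain x v d where p: "p = (tensor scale x (torus_basis 0), v, d)" and x: "x \<in> H" "\<sigma> x = x"
      using p_in by (auto simp: extended_cartan_def)
    have "tensor scale x (torus_basis (0 :: 'l)) = Poly_Mapping.single 0 x"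
      by (rule poly_mapping_eqI)
        (auto simp: tensor_def torus_basis_def Poly_Mapping.map.rep_eq lookup_single lookup_one when_def)
    then show ?thesis
      using fixed[OF x, folded \<theta>_def] by (simp add: p bar_map_eq \<theta>_def[symmetric] loop_bar_single single_uminus)
  qed
  moreover have "2 * N > 0" using N(1) by simp
  ultimately show ?thesis unfolding chevalley_automorphism_def using b_iter by blast
qed

section \<open>Graph automorphisms\<close>

context chevalley_system
begin

text \<open>\<open>\<tau>\<close> negates the coroots and hence all weights, and the root spaces of
  plus and minus a simple root are lines.\<close>

lemma chevalley_automorphism_generators:
  assumes \<tau>: "lie_automorphism scale br UNIV \<tau>" and \<tau>h: "\<And>i. \<tau> (h i) = - h i"
  shows "\<exists>c. \<tau> (e j) = scale c (f j)" "\<exists>c. \<tau> (f j) = scale c (e j)"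
proof -
  have aut: "\<tau> (br x y) = br (\<tau> x) (\<tau> y)" "\<tau> (scale c x) = scale c (\<tau> x)" for x y c
    using \<tau> by (auto simp: lie_automorphism_def)
  show "\<exists>c. \<tau> (e j) = scale c (f j)"
  proof (rule simple_root_space)
    fix i
    have "br (h i) (\<tau> (e j)) = - \<tau> (br (h i) (e j))" by (simp add: aut \<tau>h br_minus_left)
    then show "br (h i) (\<tau> (e j)) = scale (- of_int (a i j)) (\<tau> (e j))"
      by (simp add: h_e aut)
  qed
  show "\<exists>c. \<tau> (f j) = scale c (e j)"
  proof (rule chevalley_system.simple_root_space[OF opposite])
    fix i
    have "br (- h i) (\<tau> (f j)) = \<tau> (br (h i) (f j))" by (simp add: aut \<tau>h)
    then show "br (- h i) (\<tau> (f j)) = scale (- of_int (a i j)) (\<tau> (f j))"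
      by (simp add: h_f aut del: scale_minus_left)
  qed
qed

text \<open>\<open>\<tau>\<close> maps \<open>e i\<close> to \<open>c\<^sub>i\<close> times \<open>f i\<close>, and \<open>c\<close> is constant on the orbits of \<open>\<pi>\<close> because
  \<open>\<tau>\<close> commutes with \<open>\<sigma>\<close>; \<open>\<pi>'\<close> preserves these orbits.\<close>

lemma chevalley_commutes_graph:
  assumes \<tau>: "lie_automorphism scale br UNIV \<tau>" and \<tau>h: "\<And>i. \<tau> (h i) = - h i"
    and \<sigma>: "lie_automorphism scale br UNIV \<sigma>" "\<And>i. \<sigma> (e i) = e (\<pi> i)" "\<And>i. \<sigma> (f i) = f (\<pi> i)"
    and \<psi>: "lie_automorphism scale br UNIV \<psi>" "\<And>i. \<psi> (e i) = e (\<pi>' i)" "\<And>i. \<psi> (f i) = f (\<pi>' i)"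
    and comm: "\<tau> \<circ> \<sigma> = \<sigma> \<circ> \<tau>"
    and orbit: "\<And>i. \<exists>k. \<pi>' i = (\<pi> ^^ k) i"
  shows "\<psi> \<circ> \<tau> = \<tau> \<circ> \<psi>"
proof -
  have sc: "\<sigma> (scale c x) = scale c (\<sigma> x)" "\<psi> (scale c x) = scale c (\<psi> x)" for c x
    using \<sigma>(1) \<psi>(1) by (auto simp: lie_automorphism_def)
  have E: "\<tau> (e ((\<pi> ^^ k) i)) = scale c (f ((\<pi> ^^ k) i))" if "\<tau> (e i) = scale c (f i)" for k i c
  proof (induction k)
    case (Suc k)
    have "\<tau> (e ((\<pi> ^^ Suc k) i)) = \<tau> (\<sigma> (e ((\<pi> ^^ k) i)))" by (simp add: \<sigma>)
    also have "\<dots> = \<sigma> (\<tau> (e ((\<pi> ^^ k) i)))" using comm by (metis comp_apply)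
    finally show ?case by (simp add: Suc.IH sc \<sigma>)
  qed (simp add: that)
  have F: "\<tau> (f ((\<pi> ^^ k) i)) = scale c (e ((\<pi> ^^ k) i))" if "\<tau> (f i) = scale c (e i)" for k i c
  proof (induction k)
    case (Suc k)
    have "\<tau> (f ((\<pi> ^^ Suc k) i)) = \<tau> (\<sigma> (f ((\<pi> ^^ k) i)))" by (simp add: \<sigma>)
    also have "\<dots> = \<sigma> (\<tau> (f ((\<pi> ^^ k) i)))" using comm by (metis comp_apply)
    finally show ?case by (simp add: Suc.IH sc \<sigma>)
  qed (simp add: that)
  show ?thesis
  proof (rule automorphism_eqI[OF lie_automorphism_comp[OF \<psi>(1) \<tau>] lie_automorphism_comp[OF \<tau> \<psi>(1)]])
    fix i
    obtain k where k: "\<pi>' i = (\<pi> ^^ k) i" using orbit by blast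
    obtain c where c: "\<tau> (e i) = scale c (f i)" using chevalley_automorphism_generators(1)[OF \<tau> \<tau>h] by blast
    show "(\<psi> \<circ> \<tau>) (e i) = (\<tau> \<circ> \<psi>) (e i)" by (simp add: c sc \<psi> k E[OF c])
    obtain c where c: "\<tau> (f i) = scale c (e i)" using chevalley_automorphism_generators(2)[OF \<tau> \<tau>h] by blast
    show "(\<psi> \<circ> \<tau>) (f i) = (\<tau> \<circ> \<psi>) (f i)" by (simp add: c sc \<psi> k F[OF c])
  qed
qed

text \<open>Supplies what is needed of \<open>\<psi> \<circ> \<tau>\<close> when
  \<open>\<sigma>\<close> has order above 2: exchanging two legs inverts the rotation and preserves
  its orbits, and both facts carry over from nodes to generators.\<close>

lemma triality_graph_automorphisms:
  assumes \<tau>: "lie_automorphism scale br UNIV \<tau>" and \<tau>h: "\<And>i. \<tau> (h i) = - h i"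
    and \<sigma>: "graph_automorphism scale br a h e f \<sigma>" and \<sigma>2: "\<sigma> \<circ> \<sigma> \<noteq> id"
    and \<psi>: "graph_automorphism scale br a h e f \<psi>" and \<psi>2: "has_order \<psi> 2"
    and comm: "\<tau> \<circ> \<sigma> = \<sigma> \<circ> \<tau>"
  shows "\<psi> \<circ> \<tau> = \<tau> \<circ> \<psi>" "\<sigma> (\<psi> (\<sigma> x)) = \<psi> x"
    "form (\<psi> (\<tau> x)) (\<psi> (\<tau> y)) = form x y"
    "x \<in> span (range h) \<Longrightarrow> \<sigma> x = x \<Longrightarrow> \<psi> x = x"
proof -
  obtain \<pi> where \<sigma>a: "lie_automorphism scale br UNIV \<sigma>" and \<pi>: "diagram_automorphism a \<pi>"
    and \<sigma>s: "\<And>i. \<sigma> (h i) = h (\<pi> i)" "\<And>i. \<sigma> (e i) = e (\<pi> i)" "\<And>i. \<sigma> (f i) = f (\<pi> i)"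
    using \<sigma> by (auto simp: graph_automorphism_def diagram_automorphism_def)
  obtain \<pi>' where \<psi>a: "lie_automorphism scale br UNIV \<psi>" and \<pi>': "diagram_automorphism a \<pi>'"
    and \<psi>s: "\<And>i. \<psi> (h i) = h (\<pi>' i)" "\<And>i. \<psi> (e i) = e (\<pi>' i)" "\<And>i. \<psi> (f i) = f (\<pi>' i)"
    using \<psi> by (auto simp: graph_automorphism_def diagram_automorphism_def)
  have id_aut: "lie_automorphism scale br UNIV id" by (simp add: lie_automorphism_def)
  have \<psi>\<psi>: "\<psi> \<circ> \<psi> = id" and \<psi>_ne: "\<psi> \<noteq> id"
    using \<psi>2 by (auto simp: has_order_def numeral_2_eq_2 dest!: spec[of _ "Suc 0"])
  have "\<pi> \<circ> \<pi> \<noteq> id"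
  proof
    assume "\<pi> \<circ> \<pi> = id"
    then have "\<pi> (\<pi> i) = i" for i by (metis comp_apply id_apply)
    then have "\<sigma> \<circ> \<sigma> = id"
      by (intro automorphism_eqI lie_automorphism_comp \<sigma>a id_aut) (simp_all add: \<sigma>s)
    with \<sigma>2 show False by simp
  qed
  moreover have "\<pi>' \<circ> \<pi>' = id"
  proof
    fix i
    have "\<psi> (\<psi> (e i)) = e i" using \<psi>\<psi> by (metis comp_apply id_apply)
    then show "(\<pi>' \<circ> \<pi>') i = id i" by (simp add: \<psi>s e_eq_iff)
  qed
  moreover have "\<pi>' \<noteq> id"
  proof
    assume "\<pi>' = id"
    then have "\<psi> = id" by (intro automorphism_eqI \<psi>a id_aut) (simp_all add: \<psi>s)
    with \<psi>_ne show False by simp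
  qed
  ultimately have tri: "\<pi> (\<pi>' (\<pi> i)) = \<pi>' i" "\<pi>' i \<in> {i, \<pi> i, \<pi> (\<pi> i)}" "\<pi> (\<pi> (\<pi> i)) = i" for i
    using triality_involution[OF \<pi> _ \<pi>'] by blast+
  have "\<exists>k. \<pi>' i = (\<pi> ^^ k) i" for i
    using tri(2)[of i]
    by (auto intro: exI[of _ "0 :: nat"] exI[of _ "1 :: nat"] exI[of _ "2 :: nat"] simp: numeral_2_eq_2)
  then show "\<psi> \<circ> \<tau> = \<tau> \<circ> \<psi>"
    by (rule chevalley_commutes_graph[OF \<tau> \<tau>h \<sigma>a \<sigma>s(2,3) \<psi>a \<psi>s(2,3) comm])
  have "\<sigma> \<circ> \<psi> \<circ> \<sigma> = \<psi>"
    by (intro automorphism_eqI lie_automorphism_comp \<sigma>a \<psi>a) (simp_all add: \<sigma>s \<psi>s tri(1))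
  then show "\<sigma> (\<psi> (\<sigma> x)) = \<psi> x" by (metis comp_apply)
  have \<pi>'a: "a (\<pi>' i) (\<pi>' j) = a i j" for i j using \<pi>' by (simp add: diagram_automorphism_def)
  have adj: "adj root x \<longleftrightarrow> x \<noteq> root" and root: "\<pi>' root = root" for x
    using \<pi> \<open>\<pi> \<circ> \<pi> \<noteq> id\<close> \<pi>' by (metis triality)+
  \<comment> \<open>The centre is fixed by \<open>\<pi>'\<close> and joined to every leg, so its
    value determines those at \<open>i\<close> and \<open>\<pi>' i\<close> by the same
    relation.\<close>
  have t: "form (e (\<pi>' i)) (f (\<pi>' i)) = form (e i) (f i)" for i
  proof (cases "i = root")
    case False
    then have "a root i \<noteq> 0" using adj[of i] unfolding adj_def by metis
    moreover have "of_int (a root i) * form (e (\<pi>' i)) (f (\<pi>' i)) = of_int (a root i) * form (e i) (f i)"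
      using form_e_f_symmetrizes[of root i] form_e_f_symmetrizes[of root "\<pi>' i"]
        \<pi>'a[of root i] \<pi>'a[of i root] by (simp add: root)
    ultimately show ?thesis by simp
  qed (simp add: root)
  have \<psi>_minus: "\<psi> (- x) = - \<psi> x" for x
    using \<psi>a scale_minus_left[of 1] by (metis lie_automorphism_def UNIV_I scale_one)
  have "form ((\<psi> \<circ> \<tau>) x) ((\<psi> \<circ> \<tau>) y) = form x y"
    by (rule form_automorphism[OF lie_automorphism_comp[OF \<psi>a \<tau>]])
      (simp add: \<tau>h \<psi>_minus \<psi>s form_simps form_h_h \<pi>'a t)
  then show "form (\<psi> (\<tau> x)) (\<psi> (\<tau> y)) = form x y" by simp
  assume x: "x \<in> span (range h)" "\<sigma> x = x"
  have add: "\<psi> (u + v) = \<psi> u + \<psi> v" "\<sigma> (u + v) = \<sigma> u + \<sigma> v"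
    and sc: "\<psi> (scale c u) = scale c (\<psi> u)" "\<sigma> (scale c u) = scale c (\<sigma> u)" for u v c
    using \<psi>a \<sigma>a by (auto simp: lie_automorphism_def)
  \<comment> \<open>Averaging over \<open>\<sigma>\<close>: orbit sums of coroots are fixed by
    \<open>\<psi>\<close>, which permutes each orbit, and for \<open>x\<close> fixed by
    \<open>\<sigma>\<close> the sum is three times \<open>x\<close>.\<close>
  have "\<psi> (x + \<sigma> x + \<sigma> (\<sigma> x)) = x + \<sigma> x + \<sigma> (\<sigma> x)"
    using x(1)
  proof (induction rule: span_induct_alt)
    case base
    have "\<psi> 0 = 0" "\<sigma> 0 = 0" using sc(1)[of 0 0] sc(2)[of 0 0] by simp_all
    then show ?case by simp
  next
    case (step c b u)
    from step.hyps obtain j where b: "b = h j" by auto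
    have "\<pi>' (\<pi> i) = \<pi> (\<pi> (\<pi>' i))" for i using tri(1)[of i] tri(3)[of "\<pi>' (\<pi> i)"] by simp
    then have "\<psi> (b + \<sigma> b + \<sigma> (\<sigma> b)) = b + \<sigma> b + \<sigma> (\<sigma> b)"
      using tri(2)[of j] by (auto simp: b add \<sigma>s \<psi>s tri(3) ac_simps)
    moreover have "scale c b + u + \<sigma> (scale c b + u) + \<sigma> (\<sigma> (scale c b + u))
      = scale c (b + \<sigma> b + \<sigma> (\<sigma> b)) + (u + \<sigma> u + \<sigma> (\<sigma> u))"
      by (simp add: add sc scale_right_distrib ac_simps)
    ultimately show ?case using step.IH by (simp only: add(1) sc(1))
  qed
  moreover have "x + x + x = scale 3 x"
    using scale_left_distrib[of 1 1 x] scale_left_distrib[of 2 1 x] by simp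
  ultimately have "scale 3 (\<psi> x) = scale 3 x" by (simp add: x(2) sc)
  then show "\<psi> x = x" by simp
qed

end

section \<open>The cases of order 2 and of triality\<close>

theorem corollary3p29:
  fixes scale :: "complex \<Rightarrow> 'g::ab_group_add \<Rightarrow> 'g"
    and br :: "'g \<Rightarrow> 'g \<Rightarrow> 'g"
    and form :: "'g \<Rightarrow> 'g \<Rightarrow> complex"
    and H :: "'g set"
    and a :: "'i::finite \<Rightarrow> 'i \<Rightarrow> int"
    and h e f :: "'i \<Rightarrow> 'g"
    and \<tau> \<sigma> \<psi> :: "'g \<Rightarrow> 'g"
    and m :: nat
    and \<mu> :: "'l::ab_group_add \<Rightarrow> 'l \<Rightarrow> complex"
    and \<rho> :: "'l \<Rightarrow> int"
  assumes "finite_dimensional scale"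
    and "simple_lie_algebra scale br"
    and "nondegenerate_invariant_form scale br form"
    and "cartan_subalgebra scale br H"
    and "chevalley_generators scale br H a h e f"
    and "chevalley_automorphism scale br UNIV H \<tau>"
    and "graph_automorphism scale br a h e f \<sigma>" and "\<sigma> \<noteq> id" and "has_order \<sigma> m"
    and "\<tau> \<circ> \<sigma> = \<sigma> \<circ> \<tau>"
    and "m = 2 \<Longrightarrow> \<psi> = id"
    and "m \<noteq> 2 \<Longrightarrow> graph_automorphism scale br a h e f \<psi> \<and> has_order \<psi> 2"
  shows
    "(free_of_finite_rank TYPE('l) \<and> quantum_torus_cocycle \<mu> \<and>
        \<rho> \<in> epi additive_group (integer_mod_group m) \<longrightarrow>
        chevalley_automorphism
          (extended_scale scale) (extended_bracket scale br form \<mu>)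
          (extended_twisted_loop scale \<sigma> m \<rho>) (extended_cartan scale H \<sigma>)
          (bar_map \<psi> \<tau>)) \<and>
     (\<forall>\<rho>\<^sub>1 :: int \<Rightarrow> int. \<rho>\<^sub>1 \<in> epi additive_group (integer_mod_group m) \<longrightarrow>
        chevalley_automorphism
          (extended_scale scale) (extended_bracket scale br form laurent_cocycle)
          (extended_twisted_loop scale \<sigma> m \<rho>\<^sub>1) (extended_cartan scale H \<sigma>)
          (bar_map \<psi> \<tau>))"
proof -
  have L: "lie_algebra scale br" using assms(2) by (simp add: simple_lie_algebra_def)
  interpret lie_algebra scale br by (rule L)
  have H: "span (range h) = H" and indep: "independent (range h)"
    using assms(5) by (auto simp: chevalley_generators_def)
  interpret chevalley_system scale br form a h e f
  proof
    show "h i \<noteq> 0" for i using indep dependent_zero[of "range h"] by (metis rangeI)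
  qed (use assms(2,3,5) in \<open>auto simp: simple_lie_algebra_def chevalley_generators_def\<close>)
  have m: "m > 0" and \<sigma>m: "\<sigma> ^^ m = id" and \<sigma>k: "\<And>k. 0 < k \<Longrightarrow> k < m \<Longrightarrow> \<sigma> ^^ k \<noteq> id"
    using assms(9) by (auto simp: has_order_def)
  have \<tau>: "lie_automorphism scale br UNIV \<tau>" and \<tau>H: "\<And>x. x \<in> H \<Longrightarrow> \<tau> x = - x"
    using assms(6) by (auto simp: chevalley_automorphism_def)
  have \<tau>h: "\<tau> (h i) = - h i" for i using span_base[of "h i" "range h"] H by (intro \<tau>H) auto
  obtain n where n: "n > 0" "\<tau> ^^ n = id"
    using assms(6) by (auto simp: chevalley_automorphism_def fun_eq_iff)
  have \<tau>_eig: "\<tau> x \<in> eigenspace scale \<sigma> m j" if "x \<in> eigenspace scale \<sigma> m j" for x j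
  proof -
    have "\<sigma> (\<tau> x) = \<tau> (\<sigma> x)" using assms(10) by (metis comp_apply)
    then show ?thesis using that \<tau> by (simp add: eigenspace_def lie_automorphism_def)
  qed
  let ?\<omega> = "exp (2 * complex_of_real pi * \<i> / of_nat m)"
  have "lie_automorphism scale br UNIV (\<psi> \<circ> \<tau>) \<and>
    (\<forall>x y. form ((\<psi> \<circ> \<tau>) x) ((\<psi> \<circ> \<tau>) y) = form x y) \<and>
    (\<exists>N>0. (\<psi> \<circ> \<tau>) ^^ N = id) \<and>
    (\<forall>j x. x \<in> eigenspace scale \<sigma> m j \<longrightarrow> (\<psi> \<circ> \<tau>) x \<in> eigenspace scale \<sigma> m (- j)) \<and>
    (\<forall>x. x \<in> H \<longrightarrow> \<sigma> x = x \<longrightarrow> (\<psi> \<circ> \<tau>) x = - x)"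
  proof (cases "m = 2")
    case True
    then have \<psi>: "\<psi> = id" by (rule assms(11))
    have "form (\<tau> x) (\<tau> y) = form x y" for x y
      by (rule form_automorphism[OF \<tau>]) (simp add: \<tau>h form_simps)
    \<comment> \<open>Modulo 2 the degrees \<open>j\<close> and \<open>- j\<close> coincide, so
      \<open>\<tau>\<close> alone already maps the eigenspaces as required.\<close>
    moreover have "?\<omega> powi (- j) = ?\<omega> powi j" for j
      using m by (rule omega_powi_neg_cong) (simp add: True)
    then have "eigenspace scale \<sigma> m (- j) = eigenspace scale \<sigma> m j" for j
      by (simp add: eigenspace_def)
    ultimately show ?thesis using \<tau> n \<tau>_eig \<tau>H by (auto simp: \<psi>)
  next
    case False
    then have \<psi>: "graph_automorphism scale br a h e f \<psi>" "has_order \<psi> 2" using assms(12) by auto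
    \<comment> \<open>Excluding orders 1 and 2 leaves \<open>m > 2\<close>, and minimality of
      \<open>m\<close> yields a nontrivial square.\<close>
    have "m \<noteq> 1" using \<sigma>m assms(8) by auto
    then have "\<sigma> ^^ 2 \<noteq> id" using False m by (intro \<sigma>k) auto
    then have \<sigma>\<sigma>: "\<sigma> \<circ> \<sigma> \<noteq> id" by (simp add: numeral_2_eq_2)
    note tri = triality_graph_automorphisms[OF \<tau> \<tau>h assms(7) \<sigma>\<sigma> \<psi> assms(10)]
    have \<psi>a: "lie_automorphism scale br UNIV \<psi>" using \<psi>(1) by (simp add: graph_automorphism_def)
    have "lie_automorphism scale br UNIV (\<psi> \<circ> \<tau>)"
      by (rule lie_automorphism_comp[OF \<psi>a \<tau>])
    moreover have "(\<psi> \<circ> \<tau>) ^^ (2 * n) = id"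
    proof -
      have "\<psi> \<circ> \<psi> = id" using \<psi>(2) by (simp add: has_order_def numeral_2_eq_2)
      \<comment> \<open>\<open>\<psi>\<close> commutes with \<open>\<tau>\<close> and squares to the
        identity, so \<open>\<psi> \<circ> \<tau>\<close> and \<open>\<tau>\<close> have the same
        square.\<close>
      then have "(\<psi> \<circ> \<tau>) \<circ> (\<psi> \<circ> \<tau>) = \<tau> \<circ> \<tau>" using tri(1) by (metis comp_assoc id_comp)
      then have "(\<psi> \<circ> \<tau>) ^^ 2 = \<tau> ^^ 2" by (simp add: numeral_2_eq_2)
      then have "(\<psi> \<circ> \<tau>) ^^ (2 * n) = \<tau> ^^ (2 * n)" by (metis funpow_mult)
      also have "\<dots> = (\<tau> ^^ n) ^^ 2" by (simp add: funpow_mult mult.commute)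
      finally show ?thesis by (simp add: n numeral_2_eq_2)
    qed
    then have "\<exists>N>0. (\<psi> \<circ> \<tau>) ^^ N = id" using n(1) by (intro exI[of _ "2 * n"]) simp
    moreover have "\<psi> (\<tau> x) \<in> eigenspace scale \<sigma> m (- j)" if "x \<in> eigenspace scale \<sigma> m j" for x j
    proof -
      \<comment> \<open>Evaluating \<open>\<sigma> \<circ> \<psi> \<circ> \<sigma> = \<psi>\<close>
        at the eigenvector \<open>\<tau> x\<close> of \<open>\<sigma>\<close> shows that
        \<open>\<psi>\<close> inverts its eigenvalue.\<close>
      have "\<sigma> (\<tau> x) = scale (?\<omega> powi j) (\<tau> x)" using \<tau>_eig[OF that] by (simp add: eigenspace_def)
      then have "scale (?\<omega> powi j) (\<sigma> (\<psi> (\<tau> x))) = \<psi> (\<tau> x)"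
        using tri(2)[of "\<tau> x"] \<psi>a assms(7) by (simp add: lie_automorphism_def graph_automorphism_def)
      then have "scale (?\<omega> powi (- j)) (\<psi> (\<tau> x)) = scale (?\<omega> powi (- j) * ?\<omega> powi j) (\<sigma> (\<psi> (\<tau> x)))"
        by (metis scale_scale)
      also have "?\<omega> powi (- j) * ?\<omega> powi j = 1"
        by (subst power_int_add[symmetric]) auto
      finally show ?thesis by (simp add: eigenspace_def)
    qed
    moreover have "\<psi> (\<tau> x) = - x" if "x \<in> H" "\<sigma> x = x" for x
    proof -
      have "- x \<in> span (range h)" using that(1) H span_neg by auto
      moreover have "\<sigma> (- x) = - x"
        using assms(7) that(2) scale_minus_left[of 1]
        by (metis UNIV_I graph_automorphism_def lie_automorphism_def scale_one)
      ultimately show ?thesis using tri(4) \<tau>H[OF that(1)] by simp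
    qed
    ultimately show ?thesis using tri(3) by simp
  qed
  then obtain N where *: "lie_automorphism scale br UNIV (\<psi> \<circ> \<tau>)"
    "\<And>x y. form ((\<psi> \<circ> \<tau>) x) ((\<psi> \<circ> \<tau>) y) = form x y" "N > 0" "(\<psi> \<circ> \<tau>) ^^ N = id"
    "\<And>j x. x \<in> eigenspace scale \<sigma> m j \<Longrightarrow> (\<psi> \<circ> \<tau>) x \<in> eigenspace scale \<sigma> m (- j)"
    "\<And>x. x \<in> H \<Longrightarrow> \<sigma> x = x \<Longrightarrow> (\<psi> \<circ> \<tau>) x = - x"
    by blast
  show ?thesis
  proof (intro conjI impI allI)
    assume A: "free_of_finite_rank TYPE('l) \<and> quantum_torus_cocycle \<mu> \<and>
        \<rho> \<in> epi additive_group (integer_mod_group m)"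
    then have "\<mu> (- k) (- l) = \<mu> k l" for k l
      unfolding quantum_torus_cocycle_def by metis
    with A show "chevalley_automorphism
          (extended_scale scale) (extended_bracket scale br form \<mu>)
          (extended_twisted_loop scale \<sigma> m \<rho>) (extended_cartan scale H \<sigma>) (bar_map \<psi> \<tau>)"
      using * by (intro bar_map_chevalley[where N = N, OF L m]) blast+
  next
    fix \<rho>\<^sub>1 :: "int \<Rightarrow> int" assume "\<rho>\<^sub>1 \<in> epi additive_group (integer_mod_group m)"
    moreover have "laurent_cocycle (- k) (- l) = laurent_cocycle k l" for k l
      by (simp add: laurent_cocycle_def)
    ultimately show "chevalley_automorphism
          (extended_scale scale) (extended_bracket scale br form laurent_cocycle)
          (extended_twisted_loop scale \<sigma> m \<rho>\<^sub>1) (extended_cartan scale H \<sigma>) (bar_map \<psi> \<tau>)"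
      using * by (intro bar_map_chevalley[where N = N, OF L m]) blast+
  qed
qed

end
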